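(* Let $\mathcal{R}$ be right amenable, let $\mathcal{F} = (F_i)_{i \in I}$ be a right Følner net in $\mathcal{R}$, let $X$ be a non-empty strongly irreducible subshift of $Q^M$ of finite type, let $Y$ be a strongly irreducible subshift of $Q^M$ such that $\mathrm{ent}_{\mathcal{F}}(X) = \mathrm{ent}_{\mathcal{F}}(Y)$, and let $\Delta$ be a local map from $X$ to $Y$. Then $\Delta$ is surjective if and only if it is pre-injective.
   Context: Setting. A group $G$ acts transitively from the left on a non-empty set $M$; the action is written $(g,m)\mapsto g\triangleright m$. An element $m_0\in M$ and, for each $m\in M$, an element $g_{m_0,m}\in G$ with $g_{m_0,m}\triangleright m_0=m$ are fixed; $\mathcal{R}=((M,G,\triangleright),(m_0,(g_{m_0,m})_{m\in M}))$ is called a cell space. The stabiliser $G_0$ of $m_0$ is finite. The right semi-action of $G/G_0$ on $M$ is $m\triangleleft gG_0=g_{m_0,m}g\triangleright m_0$. Identify $M$ with $G/G_0$ via $m\mapsto\{g\in G: g\triangleright m_0=m\}$; then $m\triangleleft n=g_{m_0,m}\triangleright n$ for $m,n\in M$. For $A\subseteq M$, $A\triangleleft\mathfrak{g}=\{a\triangleleft\mathfrak{g}: a\in A\}$. $\mathcal{R}$ is finitely right generated, and $S$ is a fixed finite symmetric right generating set: a finite $S\subseteq G/G_0$ with $G_0\cdot S\subseteq S$ and $S^{-1}:=\{g^{-1}G_0: s\in S,\ g\in s\}\subseteq S$ such that each $m\in M$ has the form $(((m_0\triangleleft s_1)\triangleleft s_2)\cdots)\triangleleft s_k$ with $k\ge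 0$, $s_i\in S$. $d$ is the path metric on $M$ of the graph with an edge from $m$ to $m\triangleleft s$ for $m\in M$, $s\in S$. $\mathbb{B}(m,\rho)=\{m'\in M: d(m,m')\le\rho\}$ and $\mathbb{B}(\rho)=\mathbb{B}(m_0,\rho)$ for $\rho\in\mathbb{N}_0$. For $A,B\subseteq M$, $d(A,B)=\inf\{d(a,b): a\in A, b\in B\}$ (with $\inf\emptyset=\infty$). For $A\subseteq M$ and $\theta\in\mathbb{N}_0$: $A^{-\theta}=\{m\in A:\mathbb{B}(m,\theta)\subseteq A\}$, $A^{+\theta}=\{m\in M:\mathbb{B}(m,\theta)\cap A\neq\emptyset\}$, $\partial_\theta A=A^{+\theta}\setminus A^{-\theta}$. $H$ is a fixed subgroup of $G$ containing all $g_{m_0,m}$, $m\in M$; $H_0=H\cap G_0$. $Q$ is a finite set. Patterns and subshifts. For $A\subseteq M$, an $A$-pattern is a map $p\colon A\to Q$, with domain $\mathrm{dom}(p)=A$; it is finite if $A$ is finite. For $g\in G$, $g\blacktriangleright p\colon g\triangleright A\to Q$, $m\mapsto p(g^{-1}\triangleright m)$. An $A$-pattern $p$ semi-occurs in an $A'$-pattern $p'$ if there is $h\in H$ with $h\triangleright A\subseteq A'$ and $h\blacktriangleright p=p'|_{h\triangleright A}$. For a set $\mathfrak{F}$ of finite patterns, $\langle\mathfrak{F}\rangle$ is the set of $c\in Q^M$ in which no $\mathfrak{f}\in\mathfrak{F}$ semi-occurs. A subset $X\subseteq Q^M$ is a subshift of $Q^M$ if $X=\langle\mathfrak{F}\rangle$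 for some set $\mathfrak{F}$ of finite patterns; it is of finite type if $\mathfrak{F}$ can be chosen finite. A pattern is allowed in $X$ if it semi-occurs in some $x\in X$. For $X\subseteq Q^M$ and $A\subseteq M$, $X_A=\{x|_A: x\in X\}$. A subshift $X$ is $\kappa$-strongly irreducible ($\kappa\in\mathbb{N}_0$) if for all finite patterns $p,p'$ allowed in $X$ with $d(\mathrm{dom}(p),\mathrm{dom}(p'))\ge\kappa+1$ there is $x\in X$ with $x|_{\mathrm{dom}(p)}=p$ and $x|_{\mathrm{dom}(p')}=p'$; it is strongly irreducible if it is so for some $\kappa$. Local maps. For subshifts $X,Y$, a map $\Delta\colon X\to Y$ is $\kappa$-local if there are $N\subseteq\mathbb{B}(\kappa)$ with $G_0\triangleright N\subseteq N$ and $\delta\colon X_N\to Q$ with $\delta(h_0\blacktriangleright\ell)=\delta(\ell)$ for all $h_0\in H_0$, $\ell\in X_N$, such that $\Delta(x)(m)=\delta(n\mapsto x(m\triangleleft n))$ for all $x\in X$, $m\in M$; it is local if it is $\kappa$-local for some $\kappa\in\mathbb{N}_0$. $\Delta$ is pre-injective if for all $x,x'\in X$ such that $\{m: x(m)\ne x'(m)\}$ is finite and $\Delta(x)=\Delta(x')$, one has $x=x'$. Amenability and entropy. $\mathcal{R}$ is right amenable if there is a finitely additive probability measure $\mu$ on all subsets of $M$ such that $\mu(A\triangleleft\mathfrak{g})=\mu(A)$ for all $\mathfrak{g}\in G/G_0$ and all $A\subseteq M$ on which $m\mapsto m\triangleleft\mathfrak{g}$ is injective; since $G_0$ is finite, this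 is equivalent to the existence of a right Følner net, i.e. a net $(F_i)_{i\in I}$ of non-empty finite subsets of $M$ with $\lim_{i\in I}|\partial_\rho F_i|/|F_i|=0$ for every $\rho\in\mathbb{N}_0$. For such a net $\mathcal{F}$ and $X\subseteq Q^M$, the entropy is $\mathrm{ent}_{\mathcal{F}}(X)=\limsup_{i\in I}\log|X_{F_i}|/|F_i|$ (with $\log 0=-\infty$). *)

theory Defs
  imports "HOL-Analysis.Analysis" "HOL-Algebra.Group_Action" "HOL-Algebra.Left_Coset"
begin

no_notation subset_mset (infix "<#" 50)

section \<open>Nets\<close>

definition directed_on :: "'i set \<Rightarrow> ('i \<Rightarrow> 'i \<Rightarrow> bool) \<Rightarrow> bool" where
  "directed_on I leq \<longleftrightarrow> I \<noteq> {} \<and> reflp_on I leq \<and> transp_on I leq \<and>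
     (\<forall>i\<in>I. \<forall>j\<in>I. \<exists>k\<in>I. leq i k \<and> leq j k)"

text \<open>The filter of sections of a directed set: limits and upper limits along this filter are the
  limits and upper limits of nets indexed by the directed set.\<close>

definition net_filter :: "'i set \<Rightarrow> ('i \<Rightarrow> 'i \<Rightarrow> bool) \<Rightarrow> 'i filter" where
  "net_filter I leq = (INF i\<in>I. principal {j \<in> I. leq i j})"

lemma eventually_net_filter:
  assumes "directed_on I leq"
  shows "eventually P (net_filter I leq) \<longleftrightarrow> (\<exists>i\<in>I. \<forall>j\<in>I. leq i j \<longrightarrow> P j)"
proof -
  have base: "\<exists>k\<in>I. principal {l \<in> I. leq k l} \<le>
      inf (principal {l \<in> I. leq i l}) (principal {l \<in> I. leq j l})"
    if ij: "i \<in> I" "j \<in> I" for i j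
  proof -
    obtain k where k: "k \<in> I" "leq i k" "leq j k"
      using assms ij unfolding directed_on_def by blast
    have tr: "transp_on I leq"
      using assms by (simp add: directed_on_def)
    have "{l \<in> I. leq k l} \<subseteq> {l \<in> I. leq i l} \<inter> {l \<in> I. leq j l}"
      using transp_onD[OF tr ij(1) k(1)] transp_onD[OF tr ij(2) k(1)] k by blast
    with k(1) show ?thesis
      by (intro bexI[of _ k]) simp_all
  qed
  have ne: "I \<noteq> {}"
    using assms by (simp add: directed_on_def)
  have "eventually P (net_filter I leq) \<longleftrightarrow>
      (\<exists>i\<in>I. eventually P (principal {j \<in> I. leq i j}))"
    unfolding net_filter_def
    by (rule eventually_INF_base[where F = "\<lambda>i. principal {j \<in> I. leq i j}", OF ne base])
  then show ?thesis
    unfolding eventually_principal by blast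
qed

text \<open>Used for finite sets only; the logarithm of the empty set's cardinality is \<open>-\<infinity>\<close>.\<close>

definition log_card :: "'a set \<Rightarrow> ereal" where
  "log_card A = (if card A = 0 then -\<infinity> else ereal (ln (real (card A))))"

section \<open>Cell spaces\<close>

locale cell_space = transitive_action G M act
  for G (structure) and M :: "'m set" and act :: "'g \<Rightarrow> 'm \<Rightarrow> 'm" +
  fixes m0 :: 'm and coord :: "'m \<Rightarrow> 'g"
  assumes origin_in: "m0 \<in> M"
    and coord_in: "m \<in> M \<Longrightarrow> coord m \<in> carrier G"
    and coord_act: "m \<in> M \<Longrightarrow> act (coord m) m0 = m"
begin

abbreviation G0 :: "'g set" where
  "G0 \<equiv> stabilizer G act m0"

text \<open>The right semi-action of left cosets of \<^term>\<open>G0\<close> on cells. It does not depend on the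
  representative, see \<open>semi_act_l_coset\<close> below.\<close>

definition semi_act :: "'m \<Rightarrow> 'g set \<Rightarrow> 'm" where
  "semi_act m \<gg> = (THE n. \<exists>g\<in>\<gg>. n = act (coord m \<otimes> g) m0)"

text \<open>The identification of cells with left cosets of \<^term>\<open>G0\<close>.\<close>

definition coset_of :: "'m \<Rightarrow> 'g set" where
  "coset_of m = {g \<in> carrier G. act g m0 = m}"

lemma is_group: "group G"
  using group_hom by (simp add: group_hom_def)

lemma act_mult:
  assumes "g \<in> carrier G" "h \<in> carrier G" "m \<in> M"
  shows "act (g \<otimes> h) m = act g (act h m)"
  using assms composition_rule by blast

lemma semi_act_l_coset:
  assumes "m \<in> M" "g \<in> carrier G"
  shows "semi_act m (g <# G0) = act (coord m \<otimes> g) m0"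
proof -
  interpret group G by (rule is_group)
  have "act (coord m \<otimes> (g \<otimes> k)) m0 = act (coord m \<otimes> g) m0" if "k \<in> G0" for k
  proof -
    have k: "k \<in> carrier G" "act k m0 = m0"
      using that by (auto simp: stabilizer_def)
    have "act (coord m \<otimes> (g \<otimes> k)) m0 = act ((coord m \<otimes> g) \<otimes> k) m0"
      using k assms coord_in by (simp add: m_assoc)
    also have "\<dots> = act (coord m \<otimes> g) (act k m0)"
      using k assms coord_in origin_in by (intro act_mult) auto
    finally show ?thesis
      using k by simp
  qed
  then have "(\<exists>x\<in>g <# G0. n = act (coord m \<otimes> x) m0) \<longleftrightarrow> n = act (coord m \<otimes> g) m0" for n
    using stabilizer_one_closed[OF origin_in] by (auto simp: l_coset_def)
  then show ?thesis
    by (simp add: semi_act_def)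
qed

lemma semi_act_coset_of:
  assumes "m \<in> M" "n \<in> M"
  shows "semi_act m (coset_of n) = act (coord m) n"
proof -
  interpret group G by (rule is_group)
  have eq: "act (coord m \<otimes> g) m0 = act (coord m) n" if "g \<in> coset_of n" for g
    using that assms act_mult coord_in origin_in by (auto simp: coset_of_def)
  have "coord n \<in> coset_of n"
    using assms coord_in coord_act by (auto simp: coset_of_def)
  with eq have "(\<exists>g\<in>coset_of n. k = act (coord m \<otimes> g) m0) \<longleftrightarrow> k = act (coord m) n" for k
    by auto
  then show ?thesis
    by (simp add: semi_act_def)
qed

definition right_amenable :: bool where
  "right_amenable \<longleftrightarrow> (\<exists>\<mu> :: 'm set \<Rightarrow> real.
     (\<forall>A. A \<subseteq> M \<longrightarrow> 0 \<le> \<mu> A) \<and> \<mu> M = 1 \<and>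
     (\<forall>A B. A \<subseteq> M \<longrightarrow> B \<subseteq> M \<longrightarrow> A \<inter> B = {} \<longrightarrow> \<mu> (A \<union> B) = \<mu> A + \<mu> B) \<and>
     (\<forall>\<gg>\<in>lcosets G0. \<forall>A. A \<subseteq> M \<longrightarrow> inj_on (\<lambda>m. semi_act m \<gg>) A \<longrightarrow>
        \<mu> ((\<lambda>m. semi_act m \<gg>) ` A) = \<mu> A))"

definition symmetric_right_generating :: "'g set set \<Rightarrow> bool" where
  "symmetric_right_generating S \<longleftrightarrow>
     S \<subseteq> lcosets G0 \<and>
     (\<forall>k\<in>G0. \<forall>s\<in>S. k <# s \<in> S) \<and>
     (\<forall>s\<in>S. \<forall>g\<in>s. inv g <# G0 \<in> S) \<and>
     (\<forall>m\<in>M. \<exists>ss\<in>lists S. m = foldl semi_act m0 ss)"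

end

text \<open>The setting of the Garden of Eden theorem: a cell space with finite stabilisers, a finite
  symmetric right generating set \<open>S\<close>, a subgroup \<open>H\<close> of \<open>G\<close> containing all coordinates, and a
  finite set \<open>Q\<close> of states.\<close>

locale symbolic_setting = cell_space G M act m0 coord
  for G (structure) and M :: "'m set" and act :: "'g \<Rightarrow> 'm \<Rightarrow> 'm" and m0 coord +
  fixes S :: "'g set set" and H :: "'g set" and Q :: "'q set"
  assumes finite_G0: "finite (stabilizer G act m0)"
    and finite_S: "finite S"
    and generating_S: "symmetric_right_generating S"
    and subgroup_H: "subgroup H G"
    and coord_in_H: "m \<in> M \<Longrightarrow> coord m \<in> H"
    and finite_Q: "finite Q"
begin

subsection \<open>Metric notions\<close>

definition cayley_edges :: "('m \<times> 'm) set" where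
  "cayley_edges = {(m, semi_act m s) | m s. m \<in> M \<and> s \<in> S}"

text \<open>The edge relation is symmetric because \<open>S\<close> is, so that directed and undirected paths
  coincide.\<close>

lemma sym_cayley_edges: "sym cayley_edges"
proof (rule symI)
  interpret group G by (rule is_group)
  fix m m' assume "(m, m') \<in> cayley_edges"
  then obtain s where m: "m \<in> M" and s: "s \<in> S" and m': "m' = semi_act m s"
    by (auto simp: cayley_edges_def)
  obtain g where g: "g \<in> carrier G" "s = g <# G0"
    using s generating_S by (auto simp: symmetric_right_generating_def LCOSETS_def)
  have m'_eq: "m' = act (coord m \<otimes> g) m0"
    using m g m' semi_act_l_coset by simp
  have m'M: "m' \<in> M"
    using element_image[OF m_closed[OF coord_in[OF m] g(1)] origin_in] m'_eq by simp
  define h where "h = inv (coord m') \<otimes> coord m"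
  define k where "k = inv (h \<otimes> g)"
  have c: "coord m \<in> carrier G" "coord m' \<in> carrier G"
    using m m'M coord_in by auto
  then have h: "h \<in> carrier G"
    by (simp add: h_def)
  have "act (h \<otimes> g) m0 = act (inv (coord m')) (act (coord m \<otimes> g) m0)"
    using c g origin_in by (simp add: h_def m_assoc act_mult[symmetric])
  also have "\<dots> = m0"
    using orbit_sym_aux[OF c(2) origin_in coord_act[OF m'M]] m'_eq by simp
  finally have fix0: "act (h \<otimes> g) m0 = m0" .
  have "act k m0 = m0"
    using orbit_sym_aux[OF _ origin_in fix0] h g by (simp add: k_def)
  then have k: "k \<in> G0" "k \<in> carrier G"
    using h g by (auto simp: stabilizer_def k_def)
  have "inv k = h \<otimes> g"
    using h g by (simp add: k_def)
  moreover have "inv k \<in> G0"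
    using calculation h g fix0 by (simp add: stabilizer_def)
  ultimately have "h \<otimes> g \<in> G0" by simp
  have "g \<otimes> k \<in> s"
    using g k by (auto simp: l_coset_def)
  then have "inv (g \<otimes> k) <# G0 \<in> S"
    using s generating_S by (auto simp: symmetric_right_generating_def)
  moreover have "inv (g \<otimes> k) = h"
    using g h k by (simp add: k_def inv_mult_group m_assoc)
  ultimately have hS: "h <# G0 \<in> S" by simp
  have "semi_act m' (h <# G0) = act (coord m' \<otimes> h) m0"
    using m'M h by (rule semi_act_l_coset)
  also have "coord m' \<otimes> h = coord m"
    using c by (simp add: h_def m_assoc[symmetric])
  finally have eq: "semi_act m' (h <# G0) = m"
    using m coord_act by simp
  have "(m', semi_act m' (h <# G0)) \<in> cayley_edges"
    unfolding cayley_edges_def using m'M hS by blast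
  then show "(m', m) \<in> cayley_edges"
    by (simp only: eq)
qed

definition cell_dist :: "'m \<Rightarrow> 'm \<Rightarrow> nat" where
  "cell_dist m m' = (LEAST k. (m, m') \<in> cayley_edges ^^ k)"

definition set_dist :: "'m set \<Rightarrow> 'm set \<Rightarrow> enat" where
  "set_dist A B = (INF a\<in>A. INF b\<in>B. enat (cell_dist a b))"

definition cell_ball :: "'m \<Rightarrow> nat \<Rightarrow> 'm set" where
  "cell_ball m \<rho> = {m' \<in> M. cell_dist m m' \<le> \<rho>}"

definition theta_interior :: "nat \<Rightarrow> 'm set \<Rightarrow> 'm set" where
  "theta_interior \<theta> A = {m \<in> A. cell_ball m \<theta> \<subseteq> A}"

definition theta_closure :: "nat \<Rightarrow> 'm set \<Rightarrow> 'm set" where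
  "theta_closure \<theta> A = {m \<in> M. cell_ball m \<theta> \<inter> A \<noteq> {}}"

definition boundary :: "nat \<Rightarrow> 'm set \<Rightarrow> 'm set" where
  "boundary \<theta> A = theta_closure \<theta> A - theta_interior \<theta> A"

subsection \<open>Patterns and subshifts\<close>

text \<open>Patterns are partial maps from \<open>M\<close> to \<open>Q\<close>, so that an \<open>A\<close>-pattern is a pattern with
  domain \<open>A\<close>; configurations are the patterns with domain \<open>M\<close>.\<close>

definition patterns :: "('m \<rightharpoonup> 'q) set" where
  "patterns = {p. dom p \<subseteq> M \<and> ran p \<subseteq> Q}"

definition finite_patterns :: "('m \<rightharpoonup> 'q) set" where
  "finite_patterns = {p \<in> patterns. finite (dom p)}"

definition configurations :: "('m \<rightharpoonup> 'q) set" where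
  "configurations = {p \<in> patterns. dom p = M}"

definition shift :: "'g \<Rightarrow> ('m \<rightharpoonup> 'q) \<Rightarrow> ('m \<rightharpoonup> 'q)" where
  "shift g p = (\<lambda>m. if m \<in> act g ` dom p then p (act (inv g) m) else None)"

definition semi_occurs :: "('m \<rightharpoonup> 'q) \<Rightarrow> ('m \<rightharpoonup> 'q) \<Rightarrow> bool" where
  "semi_occurs p p' \<longleftrightarrow>
     (\<exists>h\<in>H. act h ` dom p \<subseteq> dom p' \<and> shift h p = p' |` (act h ` dom p))"

definition avoiding :: "('m \<rightharpoonup> 'q) set \<Rightarrow> ('m \<rightharpoonup> 'q) set" where
  "avoiding \<FF> = {c \<in> configurations. \<forall>f\<in>\<FF>. \<not> semi_occurs f c}"

definition subshift :: "('m \<rightharpoonup> 'q) set \<Rightarrow> bool" where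
  "subshift X \<longleftrightarrow> (\<exists>\<FF>. \<FF> \<subseteq> finite_patterns \<and> X = avoiding \<FF>)"

definition finite_type :: "('m \<rightharpoonup> 'q) set \<Rightarrow> bool" where
  "finite_type X \<longleftrightarrow> (\<exists>\<FF>. finite \<FF> \<and> \<FF> \<subseteq> finite_patterns \<and> X = avoiding \<FF>)"

definition allowed :: "('m \<rightharpoonup> 'q) set \<Rightarrow> ('m \<rightharpoonup> 'q) \<Rightarrow> bool" where
  "allowed X p \<longleftrightarrow> (\<exists>x\<in>X. semi_occurs p x)"

definition restrictions :: "('m \<rightharpoonup> 'q) set \<Rightarrow> 'm set \<Rightarrow> ('m \<rightharpoonup> 'q) set" where
  "restrictions X A = (\<lambda>x. x |` A) ` X"

definition k_strongly_irreducible :: "nat \<Rightarrow> ('m \<rightharpoonup> 'q) set \<Rightarrow> bool" where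
  "k_strongly_irreducible \<kappa> X \<longleftrightarrow>
     (\<forall>p\<in>finite_patterns. \<forall>p'\<in>finite_patterns.
        allowed X p \<longrightarrow> allowed X p' \<longrightarrow> enat (\<kappa> + 1) \<le> set_dist (dom p) (dom p') \<longrightarrow>
        (\<exists>x\<in>X. x |` dom p = p \<and> x |` dom p' = p'))"

definition strongly_irreducible :: "('m \<rightharpoonup> 'q) set \<Rightarrow> bool" where
  "strongly_irreducible X \<longleftrightarrow> (\<exists>\<kappa>. k_strongly_irreducible \<kappa> X)"

subsection \<open>Local maps\<close>

definition k_local :: "nat \<Rightarrow> ('m \<rightharpoonup> 'q) set \<Rightarrow> ('m \<rightharpoonup> 'q) set \<Rightarrow>
    (('m \<rightharpoonup> 'q) \<Rightarrow> ('m \<rightharpoonup> 'q)) \<Rightarrow> bool" where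
  "k_local \<kappa> X Y \<Delta> \<longleftrightarrow> \<Delta> \<in> X \<rightarrow> Y \<and>
     (\<exists>N \<delta>. N \<subseteq> cell_ball m0 \<kappa> \<and> (\<forall>g\<in>G0. act g ` N \<subseteq> N) \<and>
        \<delta> \<in> restrictions X N \<rightarrow> Q \<and>
        (\<forall>h\<in>H \<inter> G0. \<forall>l\<in>restrictions X N. \<delta> (shift h l) = \<delta> l) \<and>
        (\<forall>x\<in>X. \<forall>m\<in>M.
           \<Delta> x m = Some (\<delta> (\<lambda>n. if n \<in> N then x (semi_act m (coset_of n)) else None))))"

definition local_map :: "('m \<rightharpoonup> 'q) set \<Rightarrow> ('m \<rightharpoonup> 'q) set \<Rightarrow>
    (('m \<rightharpoonup> 'q) \<Rightarrow> ('m \<rightharpoonup> 'q)) \<Rightarrow> bool" where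
  "local_map X Y \<Delta> \<longleftrightarrow> (\<exists>\<kappa>. k_local \<kappa> X Y \<Delta>)"

definition pre_injective :: "('m \<rightharpoonup> 'q) set \<Rightarrow> (('m \<rightharpoonup> 'q) \<Rightarrow> ('m \<rightharpoonup> 'q)) \<Rightarrow> bool" where
  "pre_injective X \<Delta> \<longleftrightarrow>
     (\<forall>x\<in>X. \<forall>x'\<in>X. finite {m \<in> M. x m \<noteq> x' m} \<longrightarrow> \<Delta> x = \<Delta> x' \<longrightarrow> x = x')"

subsection \<open>Right Folner nets and entropy\<close>

definition right_folner_net :: "'i set \<Rightarrow> ('i \<Rightarrow> 'i \<Rightarrow> bool) \<Rightarrow> ('i \<Rightarrow> 'm set) \<Rightarrow> bool" where
  "right_folner_net I leq F \<longleftrightarrow> directed_on I leq \<and>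
     (\<forall>i\<in>I. F i \<subseteq> M \<and> finite (F i) \<and> F i \<noteq> {}) \<and>
     (\<forall>\<rho>. ((\<lambda>i. real (card (boundary \<rho> (F i))) / real (card (F i))) \<longlongrightarrow> 0) (net_filter I leq))"

definition entropy :: "'i set \<Rightarrow> ('i \<Rightarrow> 'i \<Rightarrow> bool) \<Rightarrow> ('i \<Rightarrow> 'm set) \<Rightarrow> ('m \<rightharpoonup> 'q) set \<Rightarrow> ereal" where
  "entropy I leq F X =
     Limsup (net_filter I leq) (\<lambda>i. log_card (restrictions X (F i)) / ereal (real (card (F i))))"

end

end

theory Submission
  imports Defs
begin

text \<open>
  Along a Folner net the logarithms of the numbers of patterns of two sets of configurations may
  differ by a multiple of the size of a boundary without changing the entropy.

  If a pattern is missing from all configurations of \<open>Z \<subseteq> Y\<close> at all cells of a set \<open>T\<close> whose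
  elements have disjoint large balls, then, since \<open>Y\<close> is strongly irreducible, each cell of \<open>T\<close>
  costs a constant factor \<open>1 - \<xi>\<close> in the number of patterns. As \<open>T\<close> can be chosen to
  occupy a positive proportion of \<open>F i\<close>, this gives \<open>ent Z < ent Y\<close>. It applies

  \<^item> to \<open>Z = \<Delta> X\<close>, if \<open>\<Delta>\<close> is not surjective: \<open>\<Delta> X\<close> is closed by compactness and
    so it misses some finite pattern of \<open>Y\<close>, at every cell by equivariance;
  \<^item> to a set of configurations of \<open>X\<close> that has the same image as \<open>X\<close>, if \<open>\<Delta>\<close> is not
    pre-injective: of two different configurations with the same image that are equal outside a
    finite set, one can be replaced by the other wherever it occurs, as \<open>X\<close> is of finite type.

  If \<open>\<Delta>\<close> is pre-injective, then \<open>ent X \<le> ent (\<Delta> X)\<close>: each \<open>F i\<close>-pattern of \<open>X\<close> extends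
  to a configuration equal to a fixed one outside a neighbourhood of \<open>F i\<close>, and the images of these
  extensions are distinct and are determined on a neighbourhood of \<open>F i\<close>.
\<close>

text \<open>Neither \<open>a\<close> nor \<open>b\<close> need converge. Eventually \<open>c\<close>
  lies below the constant \<open>l + e\<close>, and a real constant can be pulled out of an upper
  limit along a non-trivial filter; \<open>e\<close> is arbitrary.\<close>

lemma Limsup_le_add_tendsto:
  fixes a b c :: "'i \<Rightarrow> real"
  assumes net: "net \<noteq> bot"
    and le: "eventually (\<lambda>i. a i \<le> b i + c i) net" and c: "(c \<longlongrightarrow> l) net"
  shows "Limsup net (\<lambda>i. ereal (a i)) \<le> Limsup net (\<lambda>i. ereal (b i)) + ereal l"
proof (rule ereal_le_epsilon2)
  fix e :: real assume "0 < e"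
  then have "eventually (\<lambda>i. c i < l + e) net"
    using c by (intro order_tendstoD) auto
  with le have "eventually (\<lambda>i. ereal (a i) \<le> ereal (b i) + ereal (l + e)) net"
    by eventually_elim simp
  then have "Limsup net (\<lambda>i. ereal (a i)) \<le> Limsup net (\<lambda>i. ereal (b i) + ereal (l + e))"
    by (rule Limsup_mono)
  also have "\<dots> = Limsup net (\<lambda>i. ereal (b i)) + ereal (l + e)"
    using net by (intro Limsup_add_ereal_right) auto
  finally show "Limsup net (\<lambda>i. ereal (a i)) \<le> Limsup net (\<lambda>i. ereal (b i)) + ereal l + ereal e"
    by (simp add: add.assoc)
qed

context symbolic_setting
begin

interpretation group G by (rule is_group)

subsection \<open>The metric on cells\<close>

lemma act_closed [simp]: "g \<in> carrier G \<Longrightarrow> m \<in> M \<Longrightarrow> act g m \<in> M"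
  by (blast intro: element_image)

lemma act_inv_cancel [simp]:
  assumes "g \<in> carrier G" "m \<in> M"
  shows "act (inv g) (act g m) = m" "act g (act (inv g) m) = m"
  using orbit_sym_aux[OF assms refl] orbit_sym_aux[OF inv_closed[OF assms(1)] assms(2) refl] assms
  by auto

lemma act_one [simp]: "m \<in> M \<Longrightarrow> act \<one> m = m"
  by (simp flip: id_eq_one)

lemma act_inj_iff [simp]:
  "g \<in> carrier G \<Longrightarrow> m \<in> M \<Longrightarrow> n \<in> M \<Longrightarrow> act g m = act g n \<longleftrightarrow> m = n"
  by (metis act_inv_cancel(1))

lemma H_carrier: "h \<in> H \<Longrightarrow> h \<in> carrier G"
  using subgroup.mem_carrier[OF subgroup_H] .

declare coord_in [simp] coord_act [simp] origin_in [simp]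

lemma coset_rep:
  assumes "s \<in> S"
  obtains g where "g \<in> carrier G" "s = g <# G0"
  using assms generating_S that unfolding symmetric_right_generating_def LCOSETS_def by blast

lemma edge_in:
  assumes "(a, b) \<in> cayley_edges"
  shows "a \<in> M" "b \<in> M"
proof -
  obtain s where s: "a \<in> M" "s \<in> S" "b = semi_act a s"
    using assms by (auto simp: cayley_edges_def)
  obtain g where "g \<in> carrier G" "s = g <# G0"
    using coset_rep s(2) .
  then show "a \<in> M" "b \<in> M"
    using s by (simp_all add: semi_act_l_coset)
qed

lemma stabilizer_subset: "G0 \<subseteq> carrier G"
  by (auto simp: stabilizer_def)

text \<open>\<open>semi_act\<close> is defined through the coordinates and need not commute with the
  action. But \<open>coord (act g a)\<close> and \<open>g \<otimes> coord a\<close> both carry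
  \<open>m0\<close> to \<open>act g a\<close>, hence differ by an element \<open>u\<close> of the
  stabiliser, and \<open>S\<close> is closed under multiplication by \<open>u\<close> from the
  left.\<close>

lemma act_edge:
  assumes "(a, b) \<in> cayley_edges" and g: "g \<in> carrier G"
  shows "(act g a, act g b) \<in> cayley_edges"
proof -
  obtain s where s: "a \<in> M" "s \<in> S" "b = semi_act a s"
    using assms by (auto simp: cayley_edges_def)
  obtain k where k: "k \<in> carrier G" "s = k <# G0"
    using coset_rep s(2) .
  define c where "c = coord (act g a)"
  define u where "u = inv c \<otimes> (g \<otimes> coord a)"
  have c: "c \<in> carrier G" "act c m0 = act g a"
    using s g by (auto simp: c_def)
  have uc: "u \<in> carrier G"
    using c s g by (simp add: u_def)
  have "act u m0 = act (inv c) (act g a)"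
    using c(1) s(1) g by (simp add: u_def act_mult)
  also have "\<dots> = m0"
    using act_inv_cancel(1)[OF c(1) origin_in] c(2) by simp
  finally have "u \<in> G0"
    using uc by (simp add: stabilizer_def)
  then have "u <# s \<in> S"
    using s(2) generating_S by (auto simp: symmetric_right_generating_def)
  moreover have "u <# s = (u \<otimes> k) <# G0"
    using k uc by (simp add: lcos_m_assoc stabilizer_subset)
  moreover have "semi_act (act g a) ((u \<otimes> k) <# G0) = act g b"
  proof -
    have "semi_act (act g a) ((u \<otimes> k) <# G0) = act (c \<otimes> (u \<otimes> k)) m0"
      using semi_act_l_coset[of "act g a" "u \<otimes> k"] s g uc k by (simp add: c_def)
    also have "c \<otimes> (u \<otimes> k) = g \<otimes> (coord a \<otimes> k)"
      using c(1) s(1) g k(1) by (simp add: u_def m_assoc[symmetric])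
    also have "act (g \<otimes> (coord a \<otimes> k)) m0 = act g (act (coord a \<otimes> k) m0)"
      using s(1) g k(1) by (intro act_mult) auto
    also have "act (coord a \<otimes> k) m0 = b"
      using s k by (simp add: semi_act_l_coset)
    finally show ?thesis .
  qed
  ultimately show ?thesis
    unfolding cayley_edges_def using s(1) g
    by (intro CollectI exI[of _ "act g a"] exI[of _ "u <# s"]) simp
qed

lemma act_path:
  assumes "(a, b) \<in> cayley_edges ^^ k" "g \<in> carrier G"
  shows "(act g a, act g b) \<in> cayley_edges ^^ k"
  using assms(1)
proof (induction k arbitrary: b)
  case (Suc k)
  then obtain c where "(a, c) \<in> cayley_edges ^^ k" "(c, b) \<in> cayley_edges"
    by auto
  then show ?case
    using Suc.IH act_edge[OF _ assms(2)] by (meson relpow_Suc_I)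
qed simp

lemma path_sym:
  assumes "(a, b) \<in> cayley_edges ^^ k"
  shows "(b, a) \<in> cayley_edges ^^ k"
  using assms
proof (induction k arbitrary: b)
  case (Suc k)
  then obtain c where c: "(a, c) \<in> cayley_edges ^^ k" "(c, b) \<in> cayley_edges"
    by auto
  then have "(b, c) \<in> cayley_edges" "(c, a) \<in> cayley_edges ^^ k"
    using sym_cayley_edges Suc.IH by (auto dest: symD)
  then show ?case
    by (rule relpow_Suc_I2)
qed auto

lemma path_trans:
  assumes "(a, b) \<in> cayley_edges ^^ k" "(b, c) \<in> cayley_edges ^^ l"
  shows "(a, c) \<in> cayley_edges ^^ (k + l)"
  using assms by (auto simp: relpow_add)

lemma path_foldl:
  assumes "set ss \<subseteq> S" "m \<in> M"
  shows "(m, foldl semi_act m ss) \<in> cayley_edges ^^ length ss"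
  using assms
proof (induction ss arbitrary: m)
  case Nil
  show ?case by simp
next
  case (Cons s ss)
  have s: "s \<in> S" "set ss \<subseteq> S"
    using Cons.prems(1) by auto
  have e: "(m, semi_act m s) \<in> cayley_edges"
    unfolding cayley_edges_def using s(1) Cons.prems(2) by blast
  have "(semi_act m s, foldl semi_act (semi_act m s) ss) \<in> cayley_edges ^^ length ss"
    by (rule Cons.IH[OF s(2) edge_in(2)[OF e]])
  from relpow_Suc_I2[OF e this] show ?case
    by (simp only: foldl_Cons list.size add_0_right add_Suc_right)
qed

text \<open>Generation gives paths that start at \<open>m0\<close> only; the one to \<open>a\<close>
  is reversed and followed by the one to \<open>b\<close>. This is what makes the
  \<open>LEAST\<close> in \<open>cell_dist\<close> attained.\<close>

lemma path_exists:
  assumes "a \<in> M" "b \<in> M"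
  shows "\<exists>k. (a, b) \<in> cayley_edges ^^ k"
proof -
  have r: "\<exists>k. (m0, c) \<in> cayley_edges ^^ k" if "c \<in> M" for c
  proof -
    have "\<forall>m\<in>M. \<exists>ss\<in>lists S. m = foldl semi_act m0 ss"
      using generating_S unfolding symmetric_right_generating_def by (elim conjE)
    from bspec[OF this that] have "\<exists>ss\<in>lists S. c = foldl semi_act m0 ss" .
    then obtain ss where ss: "ss \<in> lists S" "c = foldl semi_act m0 ss"
      by (rule bexE)
    from ss(1) have "set ss \<subseteq> S"
      unfolding lists_eq_set by (rule CollectD)
    from path_foldl[OF this origin_in] show ?thesis
      unfolding ss(2) ..
  qed
  obtain k l where "(m0, a) \<in> cayley_edges ^^ k" "(m0, b) \<in> cayley_edges ^^ l"
    using r[OF assms(1)] r[OF assms(2)] by blast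
  from path_trans[OF path_sym[OF this(1)] this(2)] show ?thesis ..
qed

lemma cell_dist_path:
  assumes "a \<in> M" "b \<in> M"
  shows "(a, b) \<in> cayley_edges ^^ cell_dist a b"
  unfolding cell_dist_def by (rule LeastI_ex) (rule path_exists[OF assms])

lemma cell_dist_le: "(a, b) \<in> cayley_edges ^^ k \<Longrightarrow> cell_dist a b \<le> k"
  unfolding cell_dist_def by (rule Least_le)

lemma cell_dist_self [simp]: "cell_dist a a = 0"
  using cell_dist_le[of a a 0] by simp

lemma cell_dist_commute: "cell_dist a b = cell_dist b a"
proof -
  have "(a, b) \<in> cayley_edges ^^ k \<longleftrightarrow> (b, a) \<in> cayley_edges ^^ k" for k
    using path_sym by blast
  then show ?thesis
    by (simp only: cell_dist_def)
qed

lemma cell_dist_triangle: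
  assumes "a \<in> M" "b \<in> M" "c \<in> M"
  shows "cell_dist a c \<le> cell_dist a b + cell_dist b c"
  by (rule cell_dist_le[OF path_trans]; rule cell_dist_path; fact)

lemma cell_dist_act [simp]:
  assumes "a \<in> M" "b \<in> M" "g \<in> carrier G"
  shows "cell_dist (act g a) (act g b) = cell_dist a b"
proof (rule antisym)
  have le: "cell_dist (act h x) (act h y) \<le> cell_dist x y"
    if "x \<in> M" "y \<in> M" "h \<in> carrier G" for x y h
    using that by (intro cell_dist_le act_path cell_dist_path)
  show "cell_dist (act g a) (act g b) \<le> cell_dist a b"
    using le assms .
  show "cell_dist a b \<le> cell_dist (act g a) (act g b)"
    using le[of "act g a" "act g b" "inv g"] assms by simp
qed

lemma in_cell_ball: "b \<in> cell_ball a r \<longleftrightarrow> b \<in> M \<and> cell_dist a b \<le> r"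
  by (simp add: cell_ball_def)

lemma cell_ball_subset: "cell_ball a r \<subseteq> M"
  by (auto simp: in_cell_ball)

lemma act_cell_ball:
  assumes "m \<in> M" "g \<in> carrier G"
  shows "act g ` cell_ball m r = cell_ball (act g m) r"
proof (intro equalityI subsetI)
  fix x assume x: "x \<in> cell_ball (act g m) r"
  then have "x = act g (act (inv g) x)" "cell_dist m (act (inv g) x) \<le> r"
    using assms cell_dist_act[of m "act (inv g) x" g] by (auto simp: in_cell_ball)
  then have "act (inv g) x \<in> cell_ball m r"
    using x assms by (simp add: in_cell_ball)
  with \<open>x = act g (act (inv g) x)\<close> show "x \<in> act g ` cell_ball m r"
    by (rule image_eqI)
qed (use assms in \<open>auto simp: in_cell_ball\<close>)

text \<open>A cell has at most \<open>card S\<close> neighbours, so paths of a given length reach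
  finitely many cells only.\<close>

lemma finite_cell_ball:
  assumes "m \<in> M"
  shows "finite (cell_ball m r)"
proof -
  have fin: "finite {b. (m, b) \<in> cayley_edges ^^ k}" for k
  proof (induction k)
    case (Suc k)
    have "{b. (m, b) \<in> cayley_edges ^^ Suc k} \<subseteq>
        (\<Union>c \<in> {c. (m, c) \<in> cayley_edges ^^ k}. semi_act c ` S)"
      by (auto simp: cayley_edges_def)
    then show ?case
      using Suc finite_S by (meson finite_UN finite_imageI finite_subset)
  qed simp
  have "cell_ball m r \<subseteq> (\<Union>k\<le>r. {b. (m, b) \<in> cayley_edges ^^ k})"
    using cell_dist_path[OF assms] by (fastforce simp: in_cell_ball)
  then show ?thesis
    using fin by (meson finite_UN finite_atMost finite_subset)
qed

text \<open>The action is transitive and by isometries. Hence the constants of the counting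
  arguments do not depend on the centre of a ball.\<close>

lemma card_cell_ball:
  assumes "m \<in> M"
  shows "card (cell_ball m r) = card (cell_ball m0 r)"
proof -
  have "inj_on (act (coord m)) (cell_ball m0 r)"
    using assms by (auto simp: inj_on_def in_cell_ball)
  then have "card (act (coord m) ` cell_ball m0 r) = card (cell_ball m0 r)"
    by (rule card_image)
  then show ?thesis
    using act_cell_ball[of m0 "coord m" r] assms by simp
qed

lemma finite_subset_cell_ball:
  assumes "finite A" "A \<subseteq> M"
  obtains r where "A \<subseteq> cell_ball m0 r"
proof
  show "A \<subseteq> cell_ball m0 (Max (insert 0 (cell_dist m0 ` A)))"
    using assms by (auto simp: in_cell_ball)
qed

subsection \<open>Configurations and subshifts\<close>

lemma configuration_Some:
  assumes "c \<in> configurations" "m \<in> M"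
  obtains q where "c m = Some q" "q \<in> Q"
proof -
  have "m \<in> dom c" "ran c \<subseteq> Q"
    using assms by (auto simp: configurations_def patterns_def)
  then show ?thesis
    using that by (auto simp: ran_def)
qed

text \<open>Membership is a condition at each cell separately. This exhibits the configurations as a
  product, as the compactness argument requires, and shows that two of them can be glued along any
  set.\<close>

lemma configurations_iff:
  "c \<in> configurations \<longleftrightarrow> (\<forall>m. (if m \<in> M then c m \<in> Some ` Q else c m = None))"
  (is "_ \<longleftrightarrow> ?R")
proof
  assume c: "c \<in> configurations"
  then show ?R
  proof (intro allI)
    fix m show "if m \<in> M then c m \<in> Some ` Q else c m = None"
    proof (cases "m \<in> M")
      case True
      obtain q where "c m = Some q" "q \<in> Q"
        using configuration_Some[OF c True] .
      with True show ?thesis by simp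
    next
      case False
      then have "m \<notin> dom c"
        using c by (simp add: configurations_def)
      with False show ?thesis by (simp add: domIff)
    qed
  qed
next
  assume R: ?R
  have d: "dom c = M"
  proof (rule Set.set_eqI)
    fix m show "m \<in> dom c \<longleftrightarrow> m \<in> M"
      using R[rule_format, of m] by (auto split: if_splits)
  qed
  have "ran c \<subseteq> Q"
  proof
    fix q assume "q \<in> ran c"
    then obtain m where "c m = Some q"
      by (auto simp: ran_def)
    then show "q \<in> Q"
      using R[rule_format, of m] by (auto split: if_splits)
  qed
  with d show "c \<in> configurations"
    by (auto simp: configurations_def patterns_def)
qed

lemma configuration_None: "c \<in> configurations \<Longrightarrow> m \<notin> M \<Longrightarrow> c m = None"
  using configurations_iff by metis

lemma dom_configuration: "c \<in> configurations \<Longrightarrow> dom c = M"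
  by (simp add: configurations_def)

lemma configuration_eqI:
  assumes "c \<in> configurations" "c' \<in> configurations" "\<And>m. m \<in> M \<Longrightarrow> c m = c' m"
  shows "c = c'"
  using assms configuration_None by (metis ext)

lemma shift_configuration:
  assumes "c \<in> configurations" "g \<in> carrier G"
  shows "shift g c = (\<lambda>m. if m \<in> M then c (act (inv g) m) else None)"
  using assms surj_prop[of g] by (simp add: shift_def dom_configuration)

lemma shift_in_configurations:
  assumes "c \<in> configurations" "g \<in> carrier G"
  shows "shift g c \<in> configurations"
  unfolding configurations_iff
  using assms configurations_iff[of c] by (auto simp: shift_configuration)

text \<open>A configuration has domain \<open>M\<close>, so the inclusion of domains is automatic,
  and evaluating the shifted pattern at \<open>act h m\<close> cancels the inverse in
  \<open>shift\<close>.\<close>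

lemma semi_occurs_configuration:
  assumes f: "f \<in> patterns" and c: "c \<in> configurations"
  shows "semi_occurs f c \<longleftrightarrow> (\<exists>h\<in>H. \<forall>m\<in>dom f. c (act h m) = f m)"
proof -
  have "(act h ` dom f \<subseteq> dom c \<and> shift h f = c |` (act h ` dom f)) \<longleftrightarrow>
      (\<forall>m\<in>dom f. c (act h m) = f m)" if h: "h \<in> H" for h
  proof -
    have hG: "h \<in> carrier G"
      using h by (rule H_carrier)
    have dM: "dom f \<subseteq> M"
      using f by (simp add: patterns_def)
    have sub: "act h ` dom f \<subseteq> dom c"
      using dM hG by (auto simp: dom_configuration[OF c])
    have ii: "act (inv h) (act h m) = m" if "m \<in> dom f" for m
      using that dM hG by (intro act_inv_cancel) auto
    show ?thesis
    proof
      assume *: "act h ` dom f \<subseteq> dom c \<and> shift h f = c |` (act h ` dom f)"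
      show "\<forall>m\<in>dom f. c (act h m) = f m"
      proof
        fix m assume m: "m \<in> dom f"
        have "shift h f (act h m) = f m"
          using m ii[OF m] by (auto simp: shift_def)
        moreover have "shift h f (act h m) = c (act h m)"
          using * m by auto
        ultimately show "c (act h m) = f m"
          by simp
      qed
    next
      assume *: "\<forall>m\<in>dom f. c (act h m) = f m"
      have "shift h f = c |` (act h ` dom f)"
      proof
        fix m show "shift h f m = (c |` (act h ` dom f)) m"
        proof (cases "m \<in> act h ` dom f")
          case True
          then obtain n where "n \<in> dom f" "m = act h n"
            by blast
          with * ii True show ?thesis
            by (simp add: shift_def)
        qed (simp add: shift_def)
      qed
      with sub show "act h ` dom f \<subseteq> dom c \<and> shift h f = c |` (act h ` dom f)"
        by simp
    qed
  qed
  then show ?thesis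
    unfolding semi_occurs_def by blast
qed

lemma avoiding_iff:
  assumes "\<FF> \<subseteq> finite_patterns"
  shows "c \<in> avoiding \<FF> \<longleftrightarrow> c \<in> configurations \<and>
      (\<forall>f\<in>\<FF>. \<forall>h\<in>H. \<exists>m\<in>dom f. c (act h m) \<noteq> f m)"
proof -
  have "semi_occurs f c \<longleftrightarrow> (\<exists>h\<in>H. \<forall>m\<in>dom f. c (act h m) = f m)"
    if "f \<in> \<FF>" "c \<in> configurations" for f
    using that assms semi_occurs_configuration by (auto simp: finite_patterns_def)
  then show ?thesis
    unfolding avoiding_def by blast
qed

lemma finite_pattern_subset: "f \<in> finite_patterns \<Longrightarrow> dom f \<subseteq> M"
  by (simp add: finite_patterns_def patterns_def)

lemma subshift_configuration: "subshift X \<Longrightarrow> x \<in> X \<Longrightarrow> x \<in> configurations"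
  by (auto simp: subshift_def avoiding_def)

text \<open>An occurrence of \<open>f\<close> in \<open>shift k x\<close> by means of
  \<open>h\<close> is an occurrence in \<open>x\<close> by means of
  \<open>inv k \<otimes> h\<close>, which lies in \<open>H\<close> again.\<close>

lemma subshift_shift:
  assumes X: "subshift X" and x: "x \<in> X" and k: "k \<in> H"
  shows "shift k x \<in> X"
proof -
  obtain \<FF> where F: "\<FF> \<subseteq> finite_patterns" "X = avoiding \<FF>"
    using X by (auto simp: subshift_def)
  have xc: "x \<in> configurations"
    using X x by (rule subshift_configuration)
  have kG: "k \<in> carrier G"
    using k by (rule H_carrier)
  have "\<exists>m\<in>dom f. shift k x (act h m) \<noteq> f m" if f: "f \<in> \<FF>" and h: "h \<in> H" for f h
  proof -
    have "inv k \<otimes> h \<in> H"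
      using h k subgroup_H by (simp add: subgroup_def)
    then obtain m where m: "m \<in> dom f" "x (act (inv k \<otimes> h) m) \<noteq> f m"
      using x f F(2) avoiding_iff[OF F(1)] by blast
    have "m \<in> M" "h \<in> carrier G"
      using f F(1) m(1) finite_pattern_subset h H_carrier by auto
    then have "shift k x (act h m) = x (act (inv k \<otimes> h) m)"
      using kG by (simp add: shift_configuration[OF xc kG] act_mult)
    with m show ?thesis
      by metis
  qed
  then show ?thesis
    using shift_in_configurations[OF xc kG] F by (auto simp: avoiding_iff)
qed

lemma restrictions_finite:
  assumes "Z \<subseteq> configurations" "finite A" "A \<subseteq> M"
  shows "finite (restrictions Z A)" "card (restrictions Z A) \<le> card Q ^ card A"
proof -
  define e where "e = (\<lambda>p m. if m \<in> A then Some (p m) else (None :: 'q option))"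
  have sub: "restrictions Z A \<subseteq> e ` (PiE A (\<lambda>_. Q))"
  proof
    fix p assume "p \<in> restrictions Z A"
    then obtain z where z: "z \<in> Z" "p = z |` A"
      by (auto simp: restrictions_def)
    have zm: "\<exists>q. z m = Some q \<and> q \<in> Q" if "m \<in> A" for m
      using configuration_Some[of z m] z(1) assms that by blast
    then have the: "z m = Some (the (z m)) \<and> the (z m) \<in> Q" if "m \<in> A" for m
      using that by fastforce
    then have "p = e (\<lambda>m\<in>A. the (z m))"
      by (simp add: e_def z(2) restrict_map_def fun_eq_iff)
    moreover have "(\<lambda>m\<in>A. the (z m)) \<in> PiE A (\<lambda>_. Q)"
      using the by simp
    ultimately show "p \<in> e ` (PiE A (\<lambda>_. Q))"
      by blast
  qed
  have fin: "finite (PiE A (\<lambda>_. Q))"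
    using assms finite_Q by (intro finite_PiE) auto
  show "finite (restrictions Z A)"
    using sub fin by (meson finite_imageI finite_subset)
  have "card (restrictions Z A) \<le> card (e ` (PiE A (\<lambda>_. Q)))"
    using sub fin by (intro card_mono) auto
  also have "\<dots> \<le> card (PiE A (\<lambda>_. Q))"
    using fin by (rule card_image_le)
  also have "\<dots> = card Q ^ card A"
    using assms(2) by (simp add: card_PiE)
  finally show "card (restrictions Z A) \<le> card Q ^ card A" .
qed

section \<open>Gluing of configurations\<close>

lemma restrict_map_eq_iff: "x |` A = y |` A \<longleftrightarrow> (\<forall>m\<in>A. x m = y m)"
  by (auto simp: restrict_map_def fun_eq_iff)

text \<open>The two patterns are restrictions of elements of \<open>X\<close>, hence allowed by
  means of the unit of \<open>H\<close>, and the distance condition is stated cell by cell. If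
  \<open>A\<close> or \<open>B\<close> is empty, the infimum in \<open>set_dist\<close> is infinite,
  in agreement with the vacuous condition.\<close>

lemma strongly_irreducible_glue:
  assumes X: "subshift X" and si: "k_strongly_irreducible \<kappa> X"
    and x: "x \<in> X" "x' \<in> X"
    and AB: "finite A" "A \<subseteq> M" "finite B" "B \<subseteq> M"
    and far: "\<And>a b. a \<in> A \<Longrightarrow> b \<in> B \<Longrightarrow> \<kappa> < cell_dist a b"
  obtains z where "z \<in> X" "\<And>m. m \<in> A \<Longrightarrow> z m = x m" "\<And>m. m \<in> B \<Longrightarrow> z m = x' m"
proof -
  have c: "x \<in> configurations" "x' \<in> configurations"
    using x subshift_configuration[OF X] by auto
  have pat: "y |` C \<in> finite_patterns \<and> dom (y |` C) = C \<and> allowed X (y |` C)"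
    if y: "y \<in> X" and C: "finite C" "C \<subseteq> M" for y C
  proof -
    have yc: "y \<in> configurations"
      using y subshift_configuration[OF X] by auto
    have d: "dom (y |` C) = C"
      using C dom_configuration[OF yc] by auto
    have "ran (y |` C) \<subseteq> Q"
      using yc by (auto simp: configurations_def patterns_def ran_def restrict_map_def split: if_splits)
    then have fp: "y |` C \<in> finite_patterns"
      using d C by (simp add: finite_patterns_def patterns_def)
    have "\<one> \<in> H"
      using subgroup_H by (simp add: subgroup.one_closed)
    then have "semi_occurs (y |` C) y"
      using fp C by (subst semi_occurs_configuration[OF _ yc])
        (auto simp: finite_patterns_def d intro!: bexI[of _ \<one>])
    then show ?thesis
      using fp d y by (auto simp: allowed_def)
  qed
  have "enat (\<kappa> + 1) \<le> set_dist A B"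
    using far by (auto simp: set_dist_def le_INF_iff Suc_le_eq)
  then obtain z where "z \<in> X" "z |` A = x |` A" "z |` B = x' |` B"
    using si pat[OF x(1) AB(1,2)] pat[OF x(2) AB(3,4)] unfolding k_strongly_irreducible_def
    by metis
  then show thesis
    using that by (auto simp: restrict_map_eq_iff)
qed

lemma cell_dist_near:
  assumes "a \<in> cell_ball c r" "b \<in> cell_ball c r" "c \<in> M"
  shows "cell_dist a b \<le> 2 * r"
  using cell_dist_triangle[of a c b] assms by (simp add: in_cell_ball cell_dist_commute)

text \<open>Finite type in the form in which it is used: \<open>u\<close> on \<open>L\<close> can be
  continued by \<open>v\<close> off \<open>L\<close> if the two agree on the outer collar of
  \<open>L\<close> of width \<open>R\<close>. The set \<open>L\<close> may be infinite.\<close>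

definition gluing_radius :: "nat \<Rightarrow> ('m \<rightharpoonup> 'q) set \<Rightarrow> bool" where
  "gluing_radius R X \<longleftrightarrow> (\<forall>u\<in>X. \<forall>v\<in>X. \<forall>L. L \<subseteq> M \<longrightarrow>
     (\<forall>l\<in>L. \<forall>m\<in>M - L. cell_dist l m \<le> R \<longrightarrow> u m = v m) \<longrightarrow>
     (\<lambda>m. if m \<in> L then u m else v m) \<in> X)"

lemma gluing_radiusD:
  assumes "gluing_radius R X" "u \<in> X" "v \<in> X" "L \<subseteq> M"
    and "\<And>l m. l \<in> L \<Longrightarrow> m \<in> M \<Longrightarrow> m \<notin> L \<Longrightarrow> cell_dist l m \<le> R \<Longrightarrow> u m = v m"
  shows "(\<lambda>m. if m \<in> L then u m else v m) \<in> X"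
  using assms(1)[unfolded gluing_radius_def, rule_format, OF assms(2-4)] assms(5) by simp

text \<open>Let a ball of radius \<open>r\<close> contain the domains of the finitely many forbidden
  patterns. A translate of such a domain has diameter at most \<open>2 * r\<close>. If it meets
  \<open>L\<close>, the glued configuration equals \<open>u\<close> on all of it; if not, it equals
  \<open>v\<close> there.\<close>

lemma finite_type_gluing_radius:
  assumes "finite_type X"
  shows "\<exists>R. gluing_radius R X"
proof -
  obtain \<FF> where F: "finite \<FF>" "\<FF> \<subseteq> finite_patterns" "X = avoiding \<FF>"
    using assms by (auto simp: finite_type_def)
  have "finite (\<Union>f\<in>\<FF>. dom f)" "(\<Union>f\<in>\<FF>. dom f) \<subseteq> M"
    using F by (auto simp: finite_patterns_def patterns_def)
  then obtain r where r: "(\<Union>f\<in>\<FF>. dom f) \<subseteq> cell_ball m0 r"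
    using finite_subset_cell_ball by blast
  show ?thesis
    unfolding gluing_radius_def
  proof (intro exI[of _ "2 * r"] ballI allI impI)
    fix u v L
    assume uv: "u \<in> X" "v \<in> X" and L: "L \<subseteq> M"
      and eq: "\<forall>l\<in>L. \<forall>m\<in>M - L. cell_dist l m \<le> 2 * r \<longrightarrow> u m = v m"
    define w where "w = (\<lambda>m. if m \<in> L then u m else v m)"
    have wc: "w \<in> configurations"
      using uv F(2,3) by (auto simp: avoiding_iff configurations_iff w_def)
    have "\<exists>m\<in>dom f. w (act h m) \<noteq> f m" if f: "f \<in> \<FF>" and h: "h \<in> H" for f h
    proof (cases "\<exists>m\<in>dom f. act h m \<in> L")
      case True
      then obtain m where m: "m \<in> dom f" "act h m \<in> L"
        by blast
      have hG: "h \<in> carrier G"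
        using h by (rule H_carrier)
      have "w (act h n) = u (act h n)" if n: "n \<in> dom f" for n
      proof (cases "act h n \<in> L")
        case False
        have mn: "m \<in> cell_ball m0 r" "n \<in> cell_ball m0 r"
          using r f m n by auto
        then have "m \<in> M" "n \<in> M"
          by (auto simp: in_cell_ball)
        moreover have "cell_dist m n \<le> 2 * r"
          using cell_dist_near[OF mn] by simp
        ultimately have "u (act h n) = v (act h n)"
          using hG m(2) False by (intro eq[rule_format, of "act h m"]) auto
        with False show ?thesis
          by (simp add: w_def)
      qed (simp add: w_def)
      moreover obtain n where "n \<in> dom f" "u (act h n) \<noteq> f n"
        using uv(1) f h F(3) avoiding_iff[OF F(2)] by blast
      ultimately show ?thesis
        by metis
    next
      case False
      moreover obtain n where "n \<in> dom f" "v (act h n) \<noteq> f n"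
        using uv(2) f h F(3) avoiding_iff[OF F(2)] by blast
      ultimately show ?thesis
        by (auto simp: w_def intro!: bexI[of _ n])
    qed
    then show "(\<lambda>m. if m \<in> L then u m else v m) \<in> X"
      using wc F(2,3) by (simp add: avoiding_iff w_def)
  qed
qed

subsection \<open>Local maps\<close>

text \<open>The pattern read by the local rule at \<open>m\<close> is the restriction to
  \<open>N\<close> of the shift of \<open>x\<close> by \<open>inv (coord m)\<close>. As this is an
  element of \<open>H\<close>, the pattern lies in \<open>restrictions X N\<close>, where the rule
  is known to be invariant.\<close>

lemma local_map_window:
  assumes X: "subshift X" and N: "N \<subseteq> M" and x: "x \<in> X" and m: "m \<in> M"
  defines "W \<equiv> (\<lambda>n. if n \<in> N then x (semi_act m (coset_of n)) else None)"
  shows "W = (\<lambda>n. if n \<in> N then x (act (coord m) n) else None)" "W \<in> restrictions X N"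
    "dom W = N"
proof -
  have c: "x \<in> configurations"
    using X x by (rule subshift_configuration)
  show W: "W = (\<lambda>n. if n \<in> N then x (act (coord m) n) else None)"
    using N m by (auto simp: W_def semi_act_coset_of fun_eq_iff)
  have h: "inv (coord m) \<in> H"
    using m coord_in_H subgroup_H by (simp add: subgroup_def)
  have "W = shift (inv (coord m)) x |` N"
    using N m unfolding W by (auto simp: shift_configuration[OF c] restrict_map_def fun_eq_iff)
  then show "W \<in> restrictions X N"
    using subshift_shift[OF X x h] by (auto simp: restrictions_def)
  show "dom W = N"
  proof (rule Set.set_eqI)
    fix n show "n \<in> dom W \<longleftrightarrow> n \<in> N"
    proof (cases "n \<in> N")
      case True
      then have "act (coord m) n \<in> dom x"
        using N m c by (auto simp: dom_configuration)
      with True show ?thesis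
        by (simp add: W domIff)
    qed (simp add: W domIff)
  qed
qed

text \<open>Later arguments use a local map through these three properties. The delicate one is
  equivariance: the coordinates through which the rule reads its pattern need not be compatible with
  the action, and the invariance of the rule under \<open>H \<inter> G0\<close> makes up for
  that.\<close>

lemma local_mapE:
  assumes X: "subshift X" and Y: "subshift Y" and loc: "local_map X Y \<Delta>"
  obtains \<kappa> where
    "\<And>x. x \<in> X \<Longrightarrow> \<Delta> x \<in> Y"
    "\<And>x h. x \<in> X \<Longrightarrow> h \<in> H \<Longrightarrow> \<Delta> (shift h x) = shift h (\<Delta> x)"
    "\<And>x x' m. x \<in> X \<Longrightarrow> x' \<in> X \<Longrightarrow> m \<in> M \<Longrightarrow> (\<And>n. n \<in> cell_ball m \<kappa> \<Longrightarrow> x n = x' n) \<Longrightarrow>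
      \<Delta> x m = \<Delta> x' m"
proof -
  obtain \<kappa> N \<delta> where map: "\<Delta> \<in> X \<rightarrow> Y" and NB: "N \<subseteq> cell_ball m0 \<kappa>"
    and NG: "\<forall>g\<in>G0. act g ` N \<subseteq> N"
    and inv\<delta>: "\<forall>h\<in>H \<inter> G0. \<forall>l\<in>restrictions X N. \<delta> (shift h l) = \<delta> l"
    and \<Delta>: "\<forall>x\<in>X. \<forall>m\<in>M.
       \<Delta> x m = Some (\<delta> (\<lambda>n. if n \<in> N then x (semi_act m (coset_of n)) else None))"
    using loc unfolding local_map_def k_local_def by blast
  have NM: "N \<subseteq> M"
    using NB cell_ball_subset by blast
  define W where "W = (\<lambda>x m n. if n \<in> N then x (act (coord m) n) else (None :: 'q option))"
  note win = local_map_window[OF X NM]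
  have W: "\<Delta> x m = Some (\<delta> (W x m))" "W x m \<in> restrictions X N" "dom (W x m) = N"
    if "x \<in> X" "m \<in> M" for x m
    using \<Delta> that win(2,3)[OF that] unfolding win(1)[OF that] W_def[symmetric]
    by (auto simp: W_def win(1))
  show thesis
  proof (rule that[of \<kappa>])
    fix x x' m assume x: "x \<in> X" "x' \<in> X" "m \<in> M"
      and eq: "\<And>n. n \<in> cell_ball m \<kappa> \<Longrightarrow> x n = x' n"
    have "act (coord m) n \<in> cell_ball m \<kappa>" if "n \<in> N" for n
      using act_cell_ball[of m0 "coord m" \<kappa>] NB that x(3) by auto
    then have "W x m = W x' m"
      using eq by (auto simp: W_def)
    then show "\<Delta> x m = \<Delta> x' m"
      using x by (simp add: W)
  next
    fix x h assume x: "x \<in> X" and h: "h \<in> H"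
    have hG: "h \<in> carrier G"
      using h by (rule H_carrier)
    have hx: "shift h x \<in> X"
      using X x h by (rule subshift_shift)
    have xc: "x \<in> configurations"
      using X x by (rule subshift_configuration)
    have dc: "\<Delta> z \<in> configurations" if "z \<in> X" for z
      using map that subshift_configuration[OF Y] by auto
    show "\<Delta> (shift h x) = shift h (\<Delta> x)"
    proof (rule configuration_eqI)
      show "\<Delta> (shift h x) \<in> configurations" "shift h (\<Delta> x) \<in> configurations"
        using hx x dc hG shift_in_configurations by auto
      fix m assume m: "m \<in> M"
      define m' where "m' = act (inv h) m"
      have m': "m' \<in> M"
        using m hG by (simp add: m'_def)
      \<comment> \<open>This measures by how much the coordinates fail to follow \<open>h\<close>.
        It fixes \<open>m0\<close>, because \<open>coord m\<close> and
        \<open>h \<otimes> coord m'\<close> both map \<open>m0\<close> to \<open>m\<close>.\<close>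
      define g where "g = inv (coord m) \<otimes> (h \<otimes> coord m')"
      have gH: "g \<in> H"
        using m m' h subgroup_H coord_in_H by (auto simp: g_def subgroup_def)
      have gG: "g \<in> carrier G"
        using gH by (rule H_carrier)
      have "act g m0 = act (inv (coord m)) (act h m')"
        using m m' hG by (simp add: g_def act_mult)
      also have "act h m' = act (coord m) m0"
        using m hG by (simp add: m'_def)
      finally have g0: "act g m0 = m0"
        using m act_inv_cancel(1)[of "coord m" m0] by simp
      then have g: "g \<in> H \<inter> G0"
        using gH gG by (simp add: stabilizer_def)
      have ig: "inv g \<in> G0"
        using gG g0 orbit_sym_aux[OF gG origin_in g0] by (simp add: stabilizer_def)
      \<comment> \<open>Equality, not just inclusion, matters because \<open>shift g\<close> moves
        the domain by \<open>g\<close>; it follows since the inverse of \<open>g\<close> is in the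
        stabiliser too.\<close>
      have img: "act g ` N = N"
      proof
        show "act g ` N \<subseteq> N"
          using NG g by blast
        show "N \<subseteq> act g ` N"
        proof
          fix n assume n: "n \<in> N"
          then have "act (inv g) n \<in> N"
            using NG ig by blast
          moreover have "n = act g (act (inv g) n)"
            using n NM gG by auto
          ultimately show "n \<in> act g ` N"
            by blast
        qed
      qed
      have "W (shift h x) m = shift g (W x m')"
      proof
        fix n
        show "W (shift h x) m n = shift g (W x m') n"
        proof (cases "n \<in> N")
          case True
          then have nM: "n \<in> M"
            using NM by blast
          have e: "coord m' \<otimes> inv g = inv h \<otimes> coord m"
            using m m' hG by (simp add: g_def inv_mult_group m_assoc[symmetric])
          have "act (inv g) n \<in> N"
            using NG ig True by blast
          then have "shift g (W x m') n = x (act (coord m') (act (inv g) n))"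
            using True m' x by (simp add: shift_def W img) (simp add: W_def)
          also have "act (coord m') (act (inv g) n) = act (coord m' \<otimes> inv g) n"
            using m' gG nM by (simp add: act_mult)
          also have "\<dots> = act (inv h) (act (coord m) n)"
            using m nM hG unfolding e by (simp add: act_mult)
          finally show ?thesis
            using True m nM hG by (simp add: W_def shift_configuration[OF xc])
        next
          case False
          then show ?thesis
            using m' x by (simp add: shift_def W img) (simp add: W_def)
        qed
      qed
      then have "\<delta> (W (shift h x) m) = \<delta> (W x m')"
        using inv\<delta> g W(2)[OF x m'] by simp
      then have "\<Delta> (shift h x) m = \<Delta> x m'"
        using hx x m m' by (simp add: W)
      also have "\<dots> = shift h (\<Delta> x) m"
        using m by (simp add: shift_configuration[OF dc[OF x] hG] m'_def)
      finally show "\<Delta> (shift h x) m = shift h (\<Delta> x) m" .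
    qed
  qed (use map in auto)
qed

subsection \<open>Patterns missing at separated cells\<close>

lemma card_states_pos:
  assumes "c \<in> configurations"
  shows "card Q > 0"
  using configuration_Some[OF assms origin_in] finite_Q by (auto simp: card_gt_0_iff)

text \<open>If a translate of \<open>A\<close> leaves \<open>F\<close>, then \<open>p\<close> has
  the value \<open>None\<close> there and the condition at \<open>t\<close> holds trivially where
  \<open>y\<close> is defined. The balls around the cells of \<open>T\<close> are therefore required
  to lie in \<open>F\<close> wherever this set is counted.\<close>

definition missing :: "('m \<rightharpoonup> 'q) set \<Rightarrow> 'm set \<Rightarrow> 'm set \<Rightarrow> ('m \<rightharpoonup> 'q) \<Rightarrow> 'm set \<Rightarrow> ('m \<rightharpoonup> 'q) set"
  where "missing Y F A y T = {p \<in> restrictions Y F. \<forall>t\<in>T. \<exists>a\<in>A. p (act (coord t) a) \<noteq> y a}"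

text \<open>Strong irreducibility turns a pattern that misses \<open>y\<close> on \<open>A\<close> at \<open>t\<close> into one that shows
  it there, by a change in the ball around \<open>t\<close> only. At most \<open>card Q ^ card (cell_ball t (r + \<kappa>))\<close>
  patterns are turned into the same one.\<close>

lemma card_missing:
  assumes Y: "subshift Y" and si: "k_strongly_irreducible \<kappa> Y" and y: "y \<in> Y"
    and A: "A \<subseteq> cell_ball m0 r" and F: "finite F" "F \<subseteq> M"
    and T: "finite T" "T \<subseteq> M" "\<And>t. t \<in> T \<Longrightarrow> cell_ball t (r + \<kappa>) \<subseteq> F"
    and disj: "\<And>s t. s \<in> T \<Longrightarrow> t \<in> T \<Longrightarrow> s \<noteq> t \<Longrightarrow>
      cell_ball s (r + \<kappa>) \<inter> cell_ball t (r + \<kappa>) = {}"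
  shows "real (card (missing Y F A y T)) \<le>
    (1 - 1 / real (card Q) ^ card (cell_ball m0 (r + \<kappa>))) ^ card T * real (card (restrictions Y F))"
  using T disj
proof (induction T rule: finite_induct)
  case empty
  then show ?case
    by (simp add: missing_def)
next
  case (insert t T)
  define k where "k = card Q ^ card (cell_ball m0 (r + \<kappa>))"
  define U where "U = cell_ball t (r + \<kappa>)"
  have Yc: "Y \<subseteq> configurations"
    using subshift_configuration[OF Y] by blast
  have q: "card Q > 0"
    using y Yc card_states_pos by blast
  have t: "t \<in> M" and TM: "T \<subseteq> M"
    using insert.prems by auto
  have U: "finite U" "U \<subseteq> F" "U \<subseteq> M"
    using finite_cell_ball[OF t] insert.prems(2) F by (auto simp: U_def)
  have gA: "act (coord t) ` A \<subseteq> cell_ball t r"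
    using act_cell_ball[of m0 "coord t" r] A t by auto
  have gAU: "act (coord t) ` A \<subseteq> U"
    using gA by (auto simp: U_def in_cell_ball)
  define P where "P = missing Y F A y T"
  define P' where "P' = missing Y F A y (insert t T)"
  have finR: "finite (restrictions Y F)"
    using restrictions_finite[OF Yc F] by simp
  have finP: "finite P" "P' \<subseteq> P"
    using finR by (auto simp: P_def P'_def missing_def)
  have ct: "coord t \<in> H" "coord t \<in> carrier G"
    using t coord_in_H by auto
  have yt: "shift (coord t) y \<in> Y"
    using Y y ct(1) by (rule subshift_shift)
  have yc: "y \<in> configurations"
    using y Yc by blast
  \<comment> \<open>Gluing an extension of \<open>p\<close>, taken off \<open>U\<close>, to the
    translate of \<open>y\<close> around \<open>t\<close> gives a pattern that still misses
    \<open>y\<close> at the cells of \<open>T\<close> but shows it at \<open>t\<close>.\<close>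
  have "\<exists>p'\<in>P - P'. \<forall>m\<in>F - U. p' m = p m" if p: "p \<in> P" for p
  proof -
    obtain z where z: "z \<in> Y" "p = z |` F"
      using p by (auto simp: P_def missing_def restrictions_def)
    \<comment> \<open>The translate of \<open>A\<close> lies within distance \<open>r\<close> of
      \<open>t\<close>, whereas \<open>U\<close> has radius \<open>r + \<kappa>\<close>.\<close>
    have far: "\<kappa> < cell_dist a b" if "a \<in> F - U" "b \<in> act (coord t) ` A" for a b
    proof (rule ccontr)
      assume "\<not> \<kappa> < cell_dist a b"
      moreover have "b \<in> M" "cell_dist t b \<le> r" "a \<in> M"
        using that gA F by (auto simp: in_cell_ball)
      moreover have "\<not> cell_dist t a \<le> r + \<kappa>"
        using that F by (auto simp: U_def in_cell_ball)
      ultimately show False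
        using cell_dist_triangle[of t b a] t cell_dist_commute[of a b] by simp
    qed
    have fin: "finite (F - U)" "F - U \<subseteq> M" "finite (act (coord t) ` A)" "act (coord t) ` A \<subseteq> M"
      using F U gAU by (auto intro: finite_subset)
    obtain z' where z': "z' \<in> Y" "\<And>m. m \<in> F - U \<Longrightarrow> z' m = z m"
      "\<And>m. m \<in> act (coord t) ` A \<Longrightarrow> z' m = shift (coord t) y m"
      using strongly_irreducible_glue[OF Y si z(1) yt, of "F - U" "act (coord t) ` A"] far fin
      by blast
    define p' where "p' = z' |` F"
    have p'Y: "p' \<in> restrictions Y F"
      using z'(1) by (auto simp: p'_def restrictions_def)
    have eq: "\<forall>m\<in>F - U. p' m = p m"
      using z'(2) by (auto simp: p'_def z(2))
    have "p' (act (coord t) a) = y a" if "a \<in> A" for a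
    proof -
      have "a \<in> M" "act (coord t) a \<in> F"
        using that A gAU U(2) by (auto simp: in_cell_ball)
      then show ?thesis
        using z'(3)[of "act (coord t) a"] that ct t
        by (simp add: p'_def shift_configuration[OF yc])
    qed
    then have "p' \<notin> P'"
      by (auto simp: P'_def missing_def)
    \<comment> \<open>Only cells of \<open>U\<close> have changed, and the balls around the other
      cells do not meet \<open>U\<close>.\<close>
    moreover have "p' \<in> P"
    proof -
      have "\<exists>a\<in>A. p' (act (coord s) a) \<noteq> y a" if s: "s \<in> T" for s
      proof -
        obtain a where a: "a \<in> A" "p (act (coord s) a) \<noteq> y a"
          using p s by (auto simp: P_def missing_def)
        have "a \<in> cell_ball m0 r" "s \<in> M"
          using a(1) A s TM by auto
        then have "act (coord s) a \<in> cell_ball s r"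
          using act_cell_ball[of m0 "coord s" r] by auto
        then have "act (coord s) a \<in> cell_ball s (r + \<kappa>)"
          by (auto simp: in_cell_ball)
        moreover have "cell_ball s (r + \<kappa>) \<inter> U = {}" "cell_ball s (r + \<kappa>) \<subseteq> F"
          using insert.prems(2)[of s] insert.prems(3)[of s t] s insert.hyps(2) by (auto simp: U_def)
        ultimately have "act (coord s) a \<in> F - U"
          by blast
        with a eq show ?thesis
          by (intro bexI[of _ a]) auto
      qed
      then show ?thesis
        using p'Y by (simp add: P_def missing_def)
    qed
    ultimately show ?thesis
      using eq by blast
  qed
  then obtain \<phi> where \<phi>: "\<And>p. p \<in> P \<Longrightarrow> \<phi> p \<in> P - P'"
    "\<And>p m. p \<in> P \<Longrightarrow> m \<in> F - U \<Longrightarrow> \<phi> p m = p m"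
    by metis
  \<comment> \<open>Off \<open>U\<close> the pattern \<open>p\<close> is recovered from
    \<open>\<phi> p\<close>, on \<open>U\<close> from the second component; hence
    \<open>\<phi>\<close> is at most \<open>k\<close>-to-one.\<close>
  have "inj_on (\<lambda>p. (\<phi> p, p |` U)) P"
  proof (rule inj_onI)
    fix p p' assume pp: "p \<in> P" "p' \<in> P" and e: "(\<phi> p, p |` U) = (\<phi> p', p' |` U)"
    have none: "w m = None" if "w \<in> P" "m \<notin> F" for w m
      using that by (auto simp: P_def missing_def restrictions_def)
    show "p = p'"
    proof
      fix m
      show "p m = p' m"
        using \<phi>(2)[OF pp(1), of m] \<phi>(2)[OF pp(2), of m] e none[OF pp(1), of m] none[OF pp(2), of m]
        by (cases "m \<in> U"; cases "m \<in> F") (auto simp: restrict_map_eq_iff)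
    qed
  qed
  moreover have "(\<lambda>p. (\<phi> p, p |` U)) ` P \<subseteq> (P - P') \<times> restrictions Y U"
  proof -
    have "p |` U \<in> restrictions Y U" if p: "p \<in> P" for p
    proof -
      obtain z where "z \<in> Y" "p = z |` F"
        using p unfolding P_def missing_def restrictions_def by blast
      moreover have "F \<inter> U = U"
        using U(2) by blast
      ultimately show ?thesis
        by (auto simp: restrictions_def)
    qed
    with \<phi>(1) show ?thesis
      by auto
  qed
  moreover have finU: "finite (restrictions Y U)" "card (restrictions Y U) \<le> k"
    using restrictions_finite[OF Yc U(1,3)] card_cell_ball[OF t, of "r + \<kappa>"]
    by (auto simp: k_def U_def)
  ultimately have "card P \<le> card ((P - P') \<times> restrictions Y U)"
    using finP by (intro card_inj_on_le[where f = "\<lambda>p. (\<phi> p, p |` U)"]) auto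
  also have "\<dots> = (card P - card P') * card (restrictions Y U)"
    using finP by (simp add: card_cartesian_product card_Diff_subset finite_subset)
  also have "\<dots> \<le> (card P - card P') * k"
    using finU by simp
  finally have "real (card P) \<le> real ((card P - card P') * k)"
    by (rule of_nat_mono)
  also have "\<dots> = (real (card P) - real (card P')) * real k"
    using card_mono[OF finP] by simp
  \<comment> \<open>In other words, \<open>P - P'\<close> makes up at least the fraction
    \<open>1 / k\<close> of \<open>P\<close>.\<close>
  finally have "real (card P') * real k \<le> real (card P) * (real k - 1)"
    by (simp add: algebra_simps)
  moreover have k: "real k \<ge> 1"
    using q by (simp add: k_def Suc_le_eq)
  ultimately have "real (card P') \<le> (1 - 1 / real k) * real (card P)"
    by (simp add: field_simps)
  also have "(1 - 1 / real k) * real (card P) \<le>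
      (1 - 1 / real k) * ((1 - 1 / real k) ^ card T * real (card (restrictions Y F)))"
  proof (rule mult_left_mono)
    show "0 \<le> 1 - 1 / real k"
      using k by simp
  qed (use insert.IH insert.prems in \<open>simp add: P_def k_def\<close>)
  finally show ?case
    using insert.hyps by (simp add: P'_def k_def mult.assoc)
qed

text \<open>A maximal subset with disjoint \<open>r\<close>-balls does it: by maximality every cell
  of \<open>W\<close> lies within \<open>2 * r\<close> of some cell of \<open>T\<close>, so the
  balls of twice the radius cover \<open>W\<close>.\<close>

lemma separated_subset:
  assumes W: "finite W" "W \<subseteq> M"
  obtains T where "T \<subseteq> W"
    "\<And>s t. s \<in> T \<Longrightarrow> t \<in> T \<Longrightarrow> s \<noteq> t \<Longrightarrow> cell_ball s r \<inter> cell_ball t r = {}"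
    "card W \<le> card T * card (cell_ball m0 (2 * r))"
proof -
  define sep where "sep = (\<lambda>T. \<forall>s\<in>T. \<forall>t\<in>T. s \<noteq> t \<longrightarrow> cell_ball s r \<inter> cell_ball t r = {})"
  have "finite {T. T \<subseteq> W \<and> sep T}" "{T. T \<subseteq> W \<and> sep T} \<noteq> {}"
    using W by (auto simp: sep_def)
  then obtain T where T: "T \<subseteq> W" "sep T"
    and max: "\<And>T'. T' \<subseteq> W \<Longrightarrow> sep T' \<Longrightarrow> T \<subseteq> T' \<Longrightarrow> T' = T"
    using finite_has_maximal[of "{T. T \<subseteq> W \<and> sep T}"] by (metis (no_types, lifting) mem_Collect_eq)
  have cover: "W \<subseteq> (\<Union>t\<in>T. cell_ball t (2 * r))"
  proof
    fix w assume w: "w \<in> W"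
    show "w \<in> (\<Union>t\<in>T. cell_ball t (2 * r))"
    proof (cases "w \<in> T")
      case True
      then show ?thesis
        using w W by (auto simp: in_cell_ball intro!: bexI[of _ w])
    next
      case False
      then have "\<not> sep (insert w T)"
        using max[of "insert w T"] T w by blast
      then obtain t where t: "t \<in> T" "cell_ball w r \<inter> cell_ball t r \<noteq> {}"
        using T(2) unfolding sep_def by blast
      then obtain c where "c \<in> M" "cell_dist w c \<le> r" "cell_dist t c \<le> r"
        by (auto simp: in_cell_ball)
      moreover have "t \<in> M" "w \<in> M"
        using t w T W by auto
      ultimately have "w \<in> cell_ball t (2 * r)"
        using cell_dist_triangle[of t c w] cell_dist_commute[of c w] by (simp add: in_cell_ball)
      with t show ?thesis
        by blast
    qed
  qed
  have TM: "T \<subseteq> M" "finite T"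
    using T W by (auto intro: finite_subset)
  have "card W \<le> card (\<Union>t\<in>T. cell_ball t (2 * r))"
    using cover TM finite_cell_ball by (intro card_mono) auto
  also have "\<dots> \<le> (\<Sum>t\<in>T. card (cell_ball t (2 * r)))"
    using TM by (intro card_UN_le)
  also have "\<dots> = (\<Sum>t\<in>T. card (cell_ball m0 (2 * r)))"
    using TM by (intro sum.cong refl card_cell_ball) auto
  finally show thesis
    using T by (intro that[of T]) (auto simp: sep_def)
qed

subsection \<open>Images of local maps are closed\<close>

text \<open>Membership in \<open>D\<close> depends on the values on \<open>W\<close> only, so the
  complement is a union of cylinders over \<open>W\<close>. The factor \<open>{None}\<close> at
  indices outside \<open>M\<close> makes the whole product space equal to
  \<open>configurations\<close>.\<close>

lemma finitely_determined_closed: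
  assumes D: "D \<subseteq> configurations" and W: "finite W"
    and det: "\<And>c c'. c \<in> configurations \<Longrightarrow> c' \<in> D \<Longrightarrow> (\<And>m. m \<in> W \<Longrightarrow> c m = c' m) \<Longrightarrow> c \<in> D"
  shows "closedin (product_topology
    (\<lambda>m. discrete_topology (if m \<in> M then Some ` Q else {None})) UNIV) D"
proof -
  define V where "V = (\<lambda>m. if m \<in> M then Some ` Q else {None})"
  have conf: "configurations = PiE UNIV V"
    by (auto simp: configurations_iff V_def PiE_def Pi_def extensional_def split: if_splits)
  have "\<exists>U. finite {i. U i \<noteq> V i} \<and> (\<forall>i. U i \<subseteq> V i) \<and> x \<in> PiE UNIV U \<and>
      PiE UNIV U \<subseteq> configurations - D" if x: "x \<in> configurations - D" for x
  proof (intro exI conjI allI)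
    define U where "U = (\<lambda>m. if m \<in> W then {x m} else V m)"
    have xV: "x m \<in> V m" for m
      using x conf by auto
    show "finite {i. U i \<noteq> V i}"
      using W by (auto simp: U_def intro: finite_subset)
    show sub: "U i \<subseteq> V i" for i
      using xV by (auto simp: U_def)
    show "x \<in> PiE UNIV U"
      using xV by (auto simp: U_def)
    show "PiE UNIV U \<subseteq> configurations - D"
    proof
      fix c assume c: "c \<in> PiE UNIV U"
      have "x m = c m" if "m \<in> W" for m
        using c that by (auto simp: U_def PiE_def Pi_def split: if_splits)
      then have "c \<notin> D"
        using det[of x c] x by auto
      moreover have "c \<in> configurations"
        using c sub unfolding conf by blast
      ultimately show "c \<in> configurations - D"
        by simp
    qed
  qed
  then have "closedin (product_topology (\<lambda>m. discrete_topology (V m)) UNIV) D"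
    using D by (simp add: closedin_def openin_product_topology_alt conf)
  then show ?thesis
    by (simp only: V_def)
qed

text \<open>Compactness of the product: avoiding one forbidden pattern at one place and having the
  right image at one cell each involve finitely many cells, hence define closed sets. The assumption
  on finite sets gives the finite intersection property.\<close>

lemma local_image_closed:
  assumes X: "subshift X" and Y: "subshift Y" and loc: "local_map X Y \<Delta>"
    and y: "y \<in> configurations"
    and fin: "\<And>A. finite A \<Longrightarrow> A \<subseteq> M \<Longrightarrow> \<exists>x\<in>X. \<forall>m\<in>A. \<Delta> x m = y m"
  shows "y \<in> \<Delta> ` X"
proof -
  obtain \<kappa> where map: "\<And>x. x \<in> X \<Longrightarrow> \<Delta> x \<in> Y"
    and dep: "\<And>x x' m. x \<in> X \<Longrightarrow> x' \<in> X \<Longrightarrow> m \<in> M \<Longrightarrow>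
      (\<And>n. n \<in> cell_ball m \<kappa> \<Longrightarrow> x n = x' n) \<Longrightarrow> \<Delta> x m = \<Delta> x' m"
    using local_mapE[OF X Y loc] by metis
  obtain \<FF> where F: "\<FF> \<subseteq> finite_patterns" "X = avoiding \<FF>"
    using X by (auto simp: subshift_def)
  have Xc: "X \<subseteq> configurations"
    using subshift_configuration[OF X] by blast
  define top where "top = product_topology
    (\<lambda>m. discrete_topology (if m \<in> M then Some ` Q else {None})) (UNIV :: 'm set)"
  define D where "D = (\<lambda>(f :: 'm \<rightharpoonup> 'q, h). {c \<in> configurations. \<exists>m\<in>dom f. c (act h m) \<noteq> f m})"
  \<comment> \<open>A point of the product need not lie in \<open>X\<close>, where
    \<open>\<Delta>\<close> is understood. The condition on the image at \<open>m\<close> is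
    therefore phrased through some \<open>x\<close> in \<open>X\<close> that agrees with
    \<open>c\<close> on the ball.\<close>
  define E where "E = (\<lambda>m. {c \<in> configurations. \<exists>x\<in>X. \<Delta> x m = y m \<and> (\<forall>n\<in>cell_ball m \<kappa>. c n = x n)})"
  define \<U> where "\<U> = insert configurations (D ` (\<FF> \<times> H) \<union> E ` M)"
  have "compact_space top"
    unfolding top_def compact_space_product_topology
    using finite_Q by (simp add: compact_space_discrete_topology)
  moreover have "closedin top C" if "C \<in> \<U>" for C
  proof -
    consider "C = configurations" | f h where "f \<in> \<FF>" "h \<in> H" "C = D (f, h)"
      | m where "m \<in> M" "C = E m"
      using \<open>C \<in> \<U>\<close> by (auto simp: \<U>_def)
    then show ?thesis
    proof cases
      case 1
      then show ?thesis
        unfolding top_def by (intro finitely_determined_closed[where W = "{}"]) auto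
    next
      case 2
      have "finite (act h ` dom f)"
        using 2 F by (auto simp: finite_patterns_def)
      then show ?thesis
        unfolding top_def 2 by (rule finitely_determined_closed[rotated]) (fastforce simp: D_def)+
    next
      case 3
      show ?thesis
        unfolding top_def 3
        by (rule finitely_determined_closed[OF _ finite_cell_ball[OF 3(1), of \<kappa>]])
          (fastforce simp: E_def)+
    qed
  qed
  moreover have "\<Inter>\<V> \<noteq> {}" if V: "finite \<V>" "\<V> \<subseteq> \<U>" for \<V>
  proof -
    \<comment> \<open>Only the sets \<open>E m\<close> depend on \<open>y\<close>. Those that occur
      come from a finite set \<open>A\<close> of cells, and an element of \<open>X\<close> with
      image \<open>y\<close> on \<open>A\<close> lies in all the other sets as well.\<close>
    have "finite (\<V> \<inter> E ` M)" "\<V> \<inter> E ` M \<subseteq> E ` M"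
      using V by auto
    then obtain A where A: "A \<subseteq> M" "finite A" "\<V> \<inter> E ` M = E ` A"
      by (meson finite_subset_image)
    obtain x where x: "x \<in> X" "\<forall>m\<in>A. \<Delta> x m = y m"
      using fin[OF A(2,1)] by blast
    have "x \<in> C" if C: "C \<in> \<V>" for C
    proof (cases "C \<in> E ` M")
      case True
      then obtain m where "m \<in> A" "C = E m"
        using C A(3) by blast
      then show ?thesis
        using x Xc by (auto simp: E_def)
    next
      case False
      then have "C = configurations \<or> C \<in> D ` (\<FF> \<times> H)"
        using C V by (auto simp: \<U>_def)
      then show ?thesis
        using x(1) Xc avoiding_iff[OF F(1), of x] F(2) by (auto simp: D_def)
    qed
    then show ?thesis
      by blast
  qed
  ultimately have "\<Inter>\<U> \<noteq> {}"
    unfolding compact_space_fip by blast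
  then obtain c where c: "\<And>C. C \<in> \<U> \<Longrightarrow> c \<in> C"
    by blast
  have cc: "c \<in> configurations"
    using c by (simp add: \<U>_def)
  have "c \<in> D (f, h)" if "f \<in> \<FF>" "h \<in> H" for f h
    using c that by (simp add: \<U>_def)
  then have cX: "c \<in> X"
    using F cc by (auto simp: avoiding_iff D_def)
  have "\<Delta> c = y"
  proof (rule configuration_eqI)
    show "\<Delta> c \<in> configurations" "y \<in> configurations"
      using map cX y subshift_configuration[OF Y] by auto
    fix m assume m: "m \<in> M"
    then have "c \<in> E m"
      using c by (simp add: \<U>_def)
    then obtain x where "x \<in> X" "\<Delta> x m = y m" "\<forall>n\<in>cell_ball m \<kappa>. c n = x n"
      by (auto simp: E_def)
    then show "\<Delta> c m = y m"
      using dep[OF cX _ m, of x] by simp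
  qed
  with cX show ?thesis
    by blast
qed

subsection \<open>Entropy\<close>

lemma card_restrictions_pos:
  assumes "Z \<subseteq> configurations" "Z \<noteq> {}" "finite A" "A \<subseteq> M"
  shows "card (restrictions Z A) > 0"
  using restrictions_finite(1)[OF assms(1,3,4)] assms(2)
  by (auto simp: card_gt_0_iff restrictions_def)

text \<open>For non-empty \<open>Z\<close> the value \<open>-\<infinity>\<close> of
  \<open>log_card\<close> does not occur at indices in \<open>I\<close>, which are all that the
  filter sees, and the quotients are real.\<close>

lemma entropy_eq:
  assumes net: "right_folner_net I leq F" and Z: "Z \<subseteq> configurations" "Z \<noteq> {}"
  shows "entropy I leq F Z = Limsup (net_filter I leq)
    (\<lambda>i. ereal (ln (real (card (restrictions Z (F i)))) / real (card (F i))))"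
  unfolding entropy_def
proof (rule Limsup_eq)
  have dir: "directed_on I leq"
    using net by (simp add: right_folner_net_def)
  have "log_card (restrictions Z (F i)) / ereal (real (card (F i))) =
      ereal (ln (real (card (restrictions Z (F i)))) / real (card (F i)))" if i: "i \<in> I" for i
  proof -
    have "card (F i) > 0" "card (restrictions Z (F i)) > 0"
      using net i card_restrictions_pos[OF Z] by (auto simp: right_folner_net_def card_gt_0_iff)
    then show ?thesis
      by (simp add: log_card_def)
  qed
  then show "eventually (\<lambda>i. log_card (restrictions Z (F i)) / ereal (real (card (F i))) =
      ereal (ln (real (card (restrictions Z (F i)))) / real (card (F i)))) (net_filter I leq)"
    unfolding eventually_net_filter[OF dir] using dir by (auto simp: directed_on_def)
qed

lemma folner_eventually:
  assumes net: "right_folner_net I leq F"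
  shows "eventually (\<lambda>i. finite (F i) \<and> F i \<subseteq> M \<and> F i \<noteq> {}) (net_filter I leq)"
    "net_filter I leq \<noteq> bot"
proof -
  have dir: "directed_on I leq"
    using net by (simp add: right_folner_net_def)
  show "eventually (\<lambda>i. finite (F i) \<and> F i \<subseteq> M \<and> F i \<noteq> {}) (net_filter I leq)"
    unfolding eventually_net_filter[OF dir] using dir net
    by (auto simp: directed_on_def right_folner_net_def)
  have "\<not> eventually (\<lambda>_. False) (net_filter I leq)"
    unfolding eventually_net_filter[OF dir] using dir
    by (auto simp: directed_on_def reflp_on_def)
  then show "net_filter I leq \<noteq> bot"
    by (auto simp: trivial_limit_def)
qed

text \<open>The quotients eventually lie between \<open>0\<close> and \<open>ln (card Q)\<close>.
  Finiteness is what turns the loss of a positive constant into a strict inequality of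
  entropies.\<close>

lemma entropy_finite:
  assumes net: "right_folner_net I leq F" and Z: "Z \<subseteq> configurations" "Z \<noteq> {}"
  shows "\<bar>entropy I leq F Z\<bar> \<noteq> \<infinity>"
proof -
  define a where "a = (\<lambda>i. ln (real (card (restrictions Z (F i)))) / real (card (F i)))"
  have q: "card Q > 0"
    using Z card_states_pos by blast
  have "0 \<le> a i \<and> a i \<le> ln (real (card Q))" if "finite (F i) \<and> F i \<subseteq> M \<and> F i \<noteq> {}" for i
  proof -
    have F: "finite (F i)" "F i \<subseteq> M" "card (F i) > 0"
      using that by (auto simp: card_gt_0_iff)
    have r: "1 \<le> card (restrictions Z (F i))"
      using card_restrictions_pos[OF Z F(1,2)] by simp
    have "real (card (restrictions Z (F i))) \<le> real (card Q) ^ card (F i)"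
      using restrictions_finite(2)[OF Z(1) F(1,2)] by (simp flip: of_nat_power)
    then have "ln (real (card (restrictions Z (F i)))) \<le> real (card (F i)) * ln (real (card Q))"
      using r q by (simp flip: ln_realpow)
    then show ?thesis
      using F(3) r by (simp add: a_def field_simps)
  qed
  then have ev: "eventually (\<lambda>i. 0 \<le> a i \<and> a i \<le> ln (real (card Q))) (net_filter I leq)"
    using folner_eventually(1)[OF net] by (rule eventually_mono[rotated])
  have "Limsup (net_filter I leq) (\<lambda>i. ereal (a i)) \<le> ereal (ln (real (card Q)))"
    by (rule Limsup_bounded) (use ev in \<open>auto elim: eventually_mono\<close>)
  moreover have "ereal 0 \<le> Limsup (net_filter I leq) (\<lambda>i. ereal (a i))"
    by (rule le_Limsup[OF folner_eventually(2)[OF net]]) (use ev in \<open>auto elim: eventually_mono\<close>)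
  ultimately have "\<bar>Limsup (net_filter I leq) (\<lambda>i. ereal (a i))\<bar> \<noteq> \<infinity>"
    by (cases "Limsup (net_filter I leq) (\<lambda>i. ereal (a i))") auto
  then show ?thesis
    by (simp add: entropy_eq[OF net Z] a_def)
qed

text \<open>After taking logarithms and dividing by \<open>card (F i)\<close>, the last factor
  contributes \<open>ln (card Q)\<close> times the relative size of the boundary, which tends to
  \<open>0\<close> along the net.\<close>

lemma entropy_le_add:
  assumes net: "right_folner_net I leq F"
    and Z: "Z \<subseteq> configurations" "Z \<noteq> {}" and Z': "Z' \<subseteq> configurations" "Z' \<noteq> {}"
    and le: "eventually (\<lambda>i. real (card (restrictions Z (F i))) \<le>
      exp (c * real (card (F i))) * real (card (restrictions Z' (F i))) *
      real (card Q) ^ card (boundary \<theta> (F i))) (net_filter I leq)"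
  shows "entropy I leq F Z \<le> entropy I leq F Z' + ereal c"
  unfolding entropy_eq[OF net Z] entropy_eq[OF net Z']
proof (rule Limsup_le_add_tendsto[OF folner_eventually(2)[OF net]])
  have q: "card Q > 0"
    using Z card_states_pos by blast
  define \<beta> where "\<beta> = (\<lambda>i. real (card (boundary \<theta> (F i))) / real (card (F i)))"
  have "(\<beta> \<longlongrightarrow> 0) (net_filter I leq)"
    using net by (simp add: right_folner_net_def \<beta>_def)
  then have "((\<lambda>i. c + \<beta> i * ln (real (card Q))) \<longlongrightarrow> c + 0 * ln (real (card Q)))
      (net_filter I leq)"
    by (intro tendsto_intros)
  then show "((\<lambda>i. c + \<beta> i * ln (real (card Q))) \<longlongrightarrow> c) (net_filter I leq)"
    by simp
  show "eventually (\<lambda>i. ln (real (card (restrictions Z (F i)))) / real (card (F i)) \<le>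
      ln (real (card (restrictions Z' (F i)))) / real (card (F i)) +
      (c + \<beta> i * ln (real (card Q)))) (net_filter I leq)"
    using le folner_eventually(1)[OF net]
  proof eventually_elim
    case (elim i)
    define n r r' b where "n = real (card (F i))" and "r = real (card (restrictions Z (F i)))"
      and "r' = real (card (restrictions Z' (F i)))" and "b = card (boundary \<theta> (F i))"
    have pos: "n > 0" "r > 0" "r' > 0"
      using elim(2) card_restrictions_pos[OF Z] card_restrictions_pos[OF Z']
      by (auto simp: n_def r_def r'_def card_gt_0_iff)
    have "ln r \<le> ln (exp (c * n) * r' * real (card Q) ^ b)"
      using elim(1) pos by (intro ln_mono) (auto simp: n_def r_def r'_def b_def)
    also have "\<dots> = c * n + ln r' + real b * ln (real (card Q))"
      using pos q by (simp add: ln_mult ln_realpow)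
    finally have "ln r / n \<le> (c * n + ln r' + real b * ln (real (card Q))) / n"
      using pos by (simp add: divide_right_mono)
    also have "\<dots> = ln r' / n + (c + real b / n * ln (real (card Q)))"
      using pos by (simp add: field_simps)
    finally show ?case
      by (simp add: n_def r_def r'_def b_def \<beta>_def)
  qed
qed

section \<open>Counting patterns across a boundary\<close>

lemma boundary_bounds:
  assumes "F \<subseteq> M" "finite F"
  shows "finite (boundary \<theta> F)" "theta_closure \<theta> F \<subseteq> F \<union> boundary \<theta> F"
    "F - theta_interior \<theta> F \<subseteq> boundary \<theta> F" "F \<subseteq> theta_closure \<theta> F"
proof -
  have "theta_closure \<theta> F \<subseteq> (\<Union>m\<in>F. cell_ball m \<theta>)"
    using cell_dist_commute by (fastforce simp: theta_closure_def in_cell_ball)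
  then have "finite (theta_closure \<theta> F)"
    using assms finite_cell_ball by (meson finite_UN finite_subset subsetD)
  then show "finite (boundary \<theta> F)"
    by (simp add: boundary_def)
  show "F \<subseteq> theta_closure \<theta> F"
  proof
    fix m assume "m \<in> F"
    then have "m \<in> cell_ball m \<theta> \<inter> F"
      using assms by (auto simp: in_cell_ball)
    then show "m \<in> theta_closure \<theta> F"
      using \<open>m \<in> F\<close> assms by (auto simp: theta_closure_def)
  qed
  then show "F - theta_interior \<theta> F \<subseteq> boundary \<theta> F"
    by (auto simp: boundary_def)
  show "theta_closure \<theta> F \<subseteq> F \<union> boundary \<theta> F"
    by (auto simp: boundary_def theta_interior_def)
qed

text \<open>A pattern on \<open>A\<close> is put together from the patterns of the same
  configuration on \<open>B\<close> and on \<open>D\<close>. In the applications \<open>D\<close> is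
  a boundary.\<close>

lemma card_restrictions_le:
  assumes Z: "Z \<subseteq> configurations" and A: "finite A" "A \<subseteq> M" and B: "finite B" "A \<subseteq> B \<union> D"
    and D: "finite D" "D \<subseteq> M" "B \<subseteq> M"
  shows "card (restrictions Z A) \<le> card (restrictions Z B) * card Q ^ card D"
proof -
  define \<phi> where "\<phi> = (\<lambda>(p :: 'm \<rightharpoonup> 'q, p'). (p ++ p') |` A)"
  have "restrictions Z A \<subseteq> \<phi> ` (restrictions Z B \<times> restrictions Z D)"
  proof
    fix p assume "p \<in> restrictions Z A"
    then obtain z where z: "z \<in> Z" "p = z |` A"
      by (auto simp: restrictions_def)
    have "(z |` B ++ z |` D) |` A = z |` A"
      using B(2) by (auto simp: map_add_def restrict_map_def fun_eq_iff split: option.split)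
    then have "p = \<phi> (z |` B, z |` D)"
      by (simp add: z \<phi>_def)
    then show "p \<in> \<phi> ` (restrictions Z B \<times> restrictions Z D)"
      using z(1) by (auto simp: restrictions_def)
  qed
  then have "card (restrictions Z A) \<le> card (\<phi> ` (restrictions Z B \<times> restrictions Z D))"
    using restrictions_finite(1)[OF Z] B D by (intro card_mono) auto
  also have "\<dots> \<le> card (restrictions Z B \<times> restrictions Z D)"
    using restrictions_finite(1)[OF Z] B D by (intro card_image_le) auto
  also have "\<dots> \<le> card (restrictions Z B) * card Q ^ card D"
    using restrictions_finite(2)[OF Z D(1,2)] by (simp add: card_cartesian_product)
  finally show ?thesis .
qed

text \<open>The common core of both halves of the theorem. The factor for the boundary in
  \<open>bound\<close> leaves room for comparing patterns of an image with patterns in the domain of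
  a local map.\<close>

lemma entropy_less:
  assumes net: "right_folner_net I leq F"
    and Y: "subshift Y" "strongly_irreducible Y" and y: "y \<in> Y" and A: "A \<subseteq> cell_ball m0 r"
    and Z: "Z \<subseteq> configurations" "Z \<noteq> {}"
    and bound: "\<And>F T. finite F \<Longrightarrow> F \<subseteq> M \<Longrightarrow> T \<subseteq> F \<Longrightarrow> (\<And>t. t \<in> T \<Longrightarrow> cell_ball t r \<subseteq> F) \<Longrightarrow>
      (\<And>s t. s \<in> T \<Longrightarrow> t \<in> T \<Longrightarrow> s \<noteq> t \<Longrightarrow> cell_ball s r \<inter> cell_ball t r = {}) \<Longrightarrow>
      card (restrictions Z F) \<le> card (missing Y F A y T) * card Q ^ card (boundary \<theta> F)"
  shows "entropy I leq F Z < entropy I leq F Y"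
proof -
  obtain \<kappa> where si: "k_strongly_irreducible \<kappa> Y"
    using Y(2) by (auto simp: strongly_irreducible_def)
  have Yc: "Y \<subseteq> configurations"
    using subshift_configuration[OF Y(1)] by blast
  have Yne: "Y \<noteq> {}"
    using y by blast
  have q: "card Q > 0"
    using y Yc card_states_pos by blast
  define R where "R = r + \<kappa>"
  define \<xi> where "\<xi> = 1 / real (card Q) ^ card (cell_ball m0 R)"
  have \<xi>: "0 < \<xi>" "\<xi> \<le> 1"
    using q by (auto simp: \<xi>_def Suc_le_eq field_simps)
  define B where "B = card (cell_ball m0 (2 * R))"
  have "m0 \<in> cell_ball m0 (2 * R)"
    by (simp add: in_cell_ball)
  then have B: "B > 0"
    using finite_cell_ball[OF origin_in] by (auto simp: B_def card_gt_0_iff)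
  \<comment> \<open>Eventually the \<open>R\<close>-interior has more than half of the cells of
    \<open>F i\<close>, the separated set \<open>T\<close> has at least the fraction
    \<open>1 / B\<close> of these, and each cell of \<open>T\<close> costs a factor
    \<open>1 - \<xi>\<close>, which is at most \<open>exp (- \<xi>)\<close>.\<close>
  define \<epsilon> where "\<epsilon> = \<xi> / (2 * real B)"
  have \<epsilon>: "\<epsilon> > 0"
    using \<xi> B by (simp add: \<epsilon>_def)
  have "((\<lambda>i. real (card (boundary R (F i))) / real (card (F i))) \<longlongrightarrow> 0) (net_filter I leq)"
    using net by (simp add: right_folner_net_def)
  then have "eventually (\<lambda>i. real (card (boundary R (F i))) / real (card (F i)) < 1 / 2) (net_filter I leq)"
    by (rule order_tendstoD) simp
  then have "eventually (\<lambda>i. real (card (restrictions Z (F i))) \<le>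
      exp (- \<epsilon> * real (card (F i))) * real (card (restrictions Y (F i))) *
      real (card Q) ^ card (boundary \<theta> (F i))) (net_filter I leq)"
    using folner_eventually(1)[OF net]
  proof eventually_elim
    case (elim i)
    define P where "P = F i"
    have P: "finite P" "P \<subseteq> M" "card P > 0"
      using elim(2) by (auto simp: P_def card_gt_0_iff)
    define W where "W = theta_interior R P"
    have W: "finite W" "W \<subseteq> M" "W \<subseteq> P"
      using P by (auto simp: W_def theta_interior_def)
    obtain T where T: "T \<subseteq> W"
      "\<And>s t. s \<in> T \<Longrightarrow> t \<in> T \<Longrightarrow> s \<noteq> t \<Longrightarrow> cell_ball s R \<inter> cell_ball t R = {}"
      "card W \<le> card T * B"
      using separated_subset[OF W(1,2), of R] unfolding B_def by metis
    have TP: "T \<subseteq> P" "T \<subseteq> M" "finite T"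
      using T W by (auto intro: finite_subset)
    have TR: "cell_ball t R \<subseteq> P" if "t \<in> T" for t
      using T(1) that by (auto simp: W_def theta_interior_def)
    have sub: "cell_ball t r \<subseteq> cell_ball t R" for t
      by (auto simp: in_cell_ball R_def)
    have "card P - card W = card (P - W)"
      using W P by (simp add: card_Diff_subset)
    also have "\<dots> \<le> card (boundary R P)"
      using boundary_bounds[OF P(2,1)] by (intro card_mono) (auto simp: W_def)
    finally have "real (card P) - real (card W) \<le> real (card (boundary R P))"
      by linarith
    also have "\<dots> < real (card P) / 2"
      using elim(1) P(3) by (simp add: P_def field_simps)
    finally have "real (card P) < 2 * real (card W)"
      by simp
    also have "\<dots> \<le> 2 * (real (card T) * real B)"
      using T(3) by (simp flip: of_nat_mult)
    finally have cT: "\<epsilon> * real (card P) \<le> \<xi> * real (card T)"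
      using \<xi> B by (simp add: \<epsilon>_def field_simps)
    have "card (restrictions Z P) \<le> card (missing Y P A y T) * card Q ^ card (boundary \<theta> P)"
      by (rule bound) (use P TP TR T(2) sub in blast)+
    then have "real (card (restrictions Z P)) \<le>
        real (card (missing Y P A y T)) * real (card Q) ^ card (boundary \<theta> P)"
      by (simp flip: of_nat_mult of_nat_power)
    also have "real (card (missing Y P A y T)) \<le> (1 - \<xi>) ^ card T * real (card (restrictions Y P))"
      unfolding \<xi>_def R_def
      by (rule card_missing[OF Y(1) si y A P(1,2) TP(3,2)]) (use TR T(2) in \<open>auto simp: R_def\<close>)
    also have "(1 - \<xi>) ^ card T \<le> exp (- \<xi>) ^ card T"
      using \<xi> exp_ge_add_one_self[of "- \<xi>"] by (intro power_mono) auto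
    also have "exp (- \<xi>) ^ card T = exp (- \<xi> * real (card T))"
      by (simp add: exp_of_nat_mult mult.commute flip: exp_of_nat_mult)
    also have "\<dots> \<le> exp (- \<epsilon> * real (card P))"
      using cT by simp
    finally show ?case
      by (simp add: P_def mult_right_mono)
  qed
  then have "entropy I leq F Z \<le> entropy I leq F Y + ereal (- \<epsilon>)"
    by (intro entropy_le_add[OF net Z Yc Yne]) auto
  also have "\<dots> < entropy I leq F Y"
    using entropy_finite[OF net Yc Yne] \<epsilon> by (cases "entropy I leq F Y") auto
  finally show ?thesis .
qed

subsection \<open>Entropy of the image of a local map\<close>

lemma act_cell_ball_coord: "a \<in> cell_ball m0 r \<Longrightarrow> t \<in> M \<Longrightarrow> act (coord t) a \<in> cell_ball t r"
  using act_cell_ball[of m0 "coord t" r] by auto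

text \<open>Where the whole \<open>\<kappa>\<close>-ball lies in \<open>F\<close>, the image is
  determined by the pattern on \<open>F\<close>. The set \<open>Z\<close> will consist of
  configurations from which a pattern has been erased at given cells, so it need not be a
  subshift.\<close>

lemma card_local_image:
  assumes X: "Z \<subseteq> configurations" and F: "finite F" "F \<subseteq> M"
    and W: "\<And>m. m \<in> W \<Longrightarrow> m \<in> M \<and> cell_ball m \<kappa> \<subseteq> F"
    and dep: "\<And>x x' m. x \<in> Z \<Longrightarrow> x' \<in> Z \<Longrightarrow> m \<in> M \<Longrightarrow>
      (\<And>n. n \<in> cell_ball m \<kappa> \<Longrightarrow> x n = x' n) \<Longrightarrow> \<Delta> x m = \<Delta> x' m"
  shows "card (restrictions (\<Delta> ` Z) W) \<le> card (restrictions Z F)"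
proof -
  define \<psi> where "\<psi> = (\<lambda>p. \<Delta> (SOME z. z \<in> Z \<and> z |` F = p) |` W)"
  have "restrictions (\<Delta> ` Z) W \<subseteq> \<psi> ` restrictions Z F"
  proof
    fix w assume "w \<in> restrictions (\<Delta> ` Z) W"
    then obtain z where z: "z \<in> Z" "w = \<Delta> z |` W"
      by (auto simp: restrictions_def)
    define z' where "z' = (SOME z'. z' \<in> Z \<and> z' |` F = z |` F)"
    have "z' \<in> Z \<and> z' |` F = z |` F"
      unfolding z'_def by (rule someI[of _ z]) (use z in simp)
    then have z': "z' \<in> Z" "\<And>m. m \<in> F \<Longrightarrow> z' m = z m"
      by (auto simp: restrict_map_eq_iff)
    have "\<Delta> z m = \<Delta> z' m" if "m \<in> W" for m
      using dep[OF z(1) z'(1), of m] z'(2) W[OF that] by (metis subsetD)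
    then have "w = \<psi> (z |` F)"
      unfolding z(2) \<psi>_def z'_def[symmetric] by (simp add: restrict_map_eq_iff)
    then show "w \<in> \<psi> ` restrictions Z F"
      using z(1) by (auto simp: restrictions_def)
  qed
  then show ?thesis
    using restrictions_finite(1)[OF X F] by (rule surj_card_le[rotated])
qed

text \<open>\<open>x\<close> is one of two configurations with the same image that differ on a finite set only; where
  \<open>z\<close> looks like \<open>x\<close>, the other one is pasted in, at one cell of \<open>T\<close> after the other.\<close>

lemma erase_pattern:
  assumes X: "subshift X" and Y: "subshift Y" and ft: "finite_type X" and loc: "local_map X Y \<Delta>"
    and ninj: "\<not> pre_injective X \<Delta>"
  obtains x r where "x \<in> X"
    "\<And>T z. finite T \<Longrightarrow> T \<subseteq> M \<Longrightarrow>
      (\<And>s t. s \<in> T \<Longrightarrow> t \<in> T \<Longrightarrow> s \<noteq> t \<Longrightarrow> cell_ball s r \<inter> cell_ball t r = {}) \<Longrightarrow> z \<in> X \<Longrightarrow>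
      \<exists>z'\<in>X. \<Delta> z' = \<Delta> z \<and> (\<forall>t\<in>T. \<exists>a\<in>cell_ball m0 r. z' (act (coord t) a) \<noteq> x a)"
proof -
  obtain \<kappa> where map: "\<And>x. x \<in> X \<Longrightarrow> \<Delta> x \<in> Y"
    and equi: "\<And>x h. x \<in> X \<Longrightarrow> h \<in> H \<Longrightarrow> \<Delta> (shift h x) = shift h (\<Delta> x)"
    and dep: "\<And>x x' m. x \<in> X \<Longrightarrow> x' \<in> X \<Longrightarrow> m \<in> M \<Longrightarrow>
      (\<And>n. n \<in> cell_ball m \<kappa> \<Longrightarrow> x n = x' n) \<Longrightarrow> \<Delta> x m = \<Delta> x' m"
    using local_mapE[OF X Y loc] by metis
  obtain R where "gluing_radius R X"
    using finite_type_gluing_radius[OF ft] by blast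
  note glue = gluing_radiusD[OF this]
  have "\<exists>x\<in>X. \<exists>x'\<in>X. finite {m \<in> M. x m \<noteq> x' m} \<and> \<Delta> x = \<Delta> x' \<and> x \<noteq> x'"
    using ninj by (simp add: pre_injective_def)
  then obtain x x' where x: "x \<in> X" "x' \<in> X" "finite {m \<in> M. x m \<noteq> x' m}" "\<Delta> x = \<Delta> x'" "x \<noteq> x'"
    by (elim bexE conjE) (rule that; assumption)
  have conf: "\<And>z. z \<in> X \<Longrightarrow> z \<in> configurations" "\<And>z. z \<in> X \<Longrightarrow> \<Delta> z \<in> configurations"
    using map subshift_configuration X Y by blast+
  define D where "D = {m \<in> M. x m \<noteq> x' m}"
  have D: "finite D" "D \<subseteq> M"
    using x(3) by (auto simp: D_def)
  obtain d where d: "d \<in> D"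
    using configuration_eqI[OF conf(1)[OF x(1)] conf(1)[OF x(2)]] x(5) unfolding D_def by blast
  obtain r0 where r0: "D \<subseteq> cell_ball m0 r0"
    using finite_subset_cell_ball[OF D] .
  \<comment> \<open>\<open>r0\<close> covers the difference set \<open>D\<close>. The summands
    \<open>R\<close> and \<open>2 * \<kappa>\<close> ensure that the ball contains the collar of
    \<open>D\<close> needed for gluing and every \<open>\<kappa>\<close>-ball that meets
    \<open>D\<close>, as such a ball has diameter at most \<open>2 * \<kappa>\<close>.\<close>
  define r where "r = r0 + R + 2 * \<kappa>"
  have Dr: "D \<subseteq> cell_ball m0 r"
    using r0 by (auto simp: in_cell_ball r_def)
  show thesis
  proof (rule that[OF x(1)])
    fix T z assume T: "finite T" "T \<subseteq> M" and z: "z \<in> X"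
      and disj: "\<And>s t. s \<in> T \<Longrightarrow> t \<in> T \<Longrightarrow> s \<noteq> t \<Longrightarrow> cell_ball s r \<inter> cell_ball t r = {}"
    show "\<exists>z'\<in>X. \<Delta> z' = \<Delta> z \<and> (\<forall>t\<in>T. \<exists>a\<in>cell_ball m0 r. z' (act (coord t) a) \<noteq> x a)"
      using T disj
    proof (induction T rule: finite_induct)
      case empty
      with z show ?case by auto
    next
      case (insert t T)
      have t: "t \<in> M" "T \<subseteq> M"
        using insert.prems by auto
      have "\<exists>z'\<in>X. \<Delta> z' = \<Delta> z \<and> (\<forall>t\<in>T. \<exists>a\<in>cell_ball m0 r. z' (act (coord t) a) \<noteq> x a)"
        using insert.prems by (intro insert.IH) auto
      then obtain z' where z': "z' \<in> X" "\<Delta> z' = \<Delta> z"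
        "\<And>s. s \<in> T \<Longrightarrow> \<exists>a\<in>cell_ball m0 r. z' (act (coord s) a) \<noteq> x a"
        by blast
      show ?case
      proof (cases "\<exists>a\<in>cell_ball m0 r. z' (act (coord t) a) \<noteq> x a")
        case True
        with z' show ?thesis
          by (intro bexI[of _ z']) auto
      next
        case False
        define g where "g = coord t"
        have g: "g \<in> H" "g \<in> carrier G"
          using t coord_in_H by (auto simp: g_def)
        define L where "L = act g ` D"
        have L: "L \<subseteq> M"
          using D(2) g(2) by (auto simp: L_def)
        define u v where "u = shift g x'" and "v = shift g x"
        have uv: "u \<in> X" "v \<in> X"
          using subshift_shift[OF X] x(1,2) g(1) by (auto simp: u_def v_def)
        have uvM: "u m = x' (act (inv g) m)" "v m = x (act (inv g) m)" if "m \<in> M" for m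
          using that g(2) conf(1) x(1,2) by (simp_all add: u_def v_def shift_configuration)
        have uv_eq: "u m = v m" if "m \<in> M" "m \<notin> L" for m
        proof -
          have "m = act g (act (inv g) m)"
            using that g(2) by simp
          then have "act (inv g) m \<notin> D"
            using that(2) unfolding L_def by blast
          then show ?thesis
            using that g(2) by (simp add: uvM D_def)
        qed
        have near: "v m = z' m" if l: "l \<in> L" and m: "m \<in> M" and lm: "cell_dist l m \<le> R + 2 * \<kappa>" for l m
        proof -
          define a where "a = act (inv g) m"
          have a: "a \<in> M" "act g a = m"
            using m g(2) by (auto simp: a_def)
          obtain e where e: "e \<in> D" "l = act g e"
            using l unfolding L_def by blast
          have "e \<in> M" "cell_dist m0 e \<le> r0"
            using e(1) r0 by (auto simp: in_cell_ball)
          moreover have "cell_dist e a \<le> R + 2 * \<kappa>"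
            using lm e(2) a g(2) \<open>e \<in> M\<close> by (metis cell_dist_act)
          ultimately have "a \<in> cell_ball m0 r"
            using cell_dist_triangle[of m0 e a] a(1) by (simp add: in_cell_ball r_def)
          then have "z' m = x a"
            using False a(2) by (auto simp: g_def)
          then show ?thesis
            using m by (simp add: uvM a_def)
        qed
        define z'' where "z'' = (\<lambda>m. if m \<in> L then u m else z' m)"
        \<comment> \<open>On the collar of \<open>L\<close>, \<open>u\<close> equals
          \<open>v\<close> because the cells are outside \<open>L\<close>, and \<open>v\<close>
          equals \<open>z'\<close> by \<open>near\<close>.\<close>
        have z''X: "z'' \<in> X"
          unfolding z''_def using near uv_eq by (intro glue uv(1) z'(1) L) fastforce
        have "\<Delta> z'' = \<Delta> z'"
        proof (rule configuration_eqI)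
          fix m assume m: "m \<in> M"
          show "\<Delta> z'' m = \<Delta> z' m"
          \<comment> \<open>If the ball misses \<open>L\<close>, nothing has changed on it.
            Otherwise \<open>z''\<close> equals \<open>u\<close> and \<open>z'\<close> equals
            \<open>v\<close> on the whole ball, and \<open>u\<close> and \<open>v\<close> have the
            same image by equivariance.\<close>
          proof (cases "cell_ball m \<kappa> \<inter> L = {}")
            case True
            then show ?thesis
              by (intro dep z''X z'(1) m) (auto simp: z''_def)
          next
            case False
            then obtain l where l: "l \<in> L" "l \<in> M" "l \<in> cell_ball m \<kappa>"
              using L by blast
            have vz: "v n = z' n" if "n \<in> cell_ball m \<kappa>" for n
              using near[OF l(1), of n] that cell_dist_near[OF l(3) that m] by (simp add: in_cell_ball)
            have "z'' n = u n" if "n \<in> cell_ball m \<kappa>" for n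
              using vz[OF that] uv_eq[of n] that by (auto simp: z''_def in_cell_ball)
            then have "\<Delta> z'' m = \<Delta> u m"
              by (intro dep z''X uv m)
            also have "\<Delta> u = \<Delta> v"
              using equi x g(1) by (simp add: u_def v_def)
            also have "\<Delta> v m = \<Delta> z' m"
              using vz by (intro dep z'(1) uv m)
            finally show ?thesis .
          qed
        qed (rule conf(2)[OF z''X] conf(2)[OF z'(1)])+
        \<comment> \<open>At \<open>t\<close> the translate of \<open>d\<close> now carries the
          value of \<open>x'\<close>, which differs from that of \<open>x\<close>. At the other
          cells the earlier witness survives, as \<open>L\<close> lies in the ball around
          \<open>t\<close>.\<close>
        moreover have "\<exists>a\<in>cell_ball m0 r. z'' (act (coord s) a) \<noteq> x a" if s: "s \<in> insert t T" for s
        proof (cases "s = t")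
          case True
          have "act g d \<in> L" "d \<in> M"
            using d D by (auto simp: L_def)
          then have "z'' (act g d) = x' d"
            using uvM[of "act g d"] g(2) by (simp add: z''_def)
          then show ?thesis
            using True d Dr by (auto simp: g_def D_def intro!: bexI[of _ d])
        next
          case False
          then have sT: "s \<in> T" "s \<in> M"
            using s t by auto
          obtain a where a: "a \<in> cell_ball m0 r" "z' (act (coord s) a) \<noteq> x a"
            using z'(3)[OF sT(1)] by blast
          have "L \<subseteq> cell_ball t r"
            using Dr act_cell_ball_coord[OF _ t(1)] by (auto simp: L_def g_def)
          then have "act (coord s) a \<notin> L"
            using act_cell_ball_coord[OF a(1) sT(2)] insert.prems(2)[of s t] False s by auto
          with a show ?thesis
            by (intro bexI[of _ a]) (auto simp: z''_def)
        qed
        ultimately show ?thesis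
          using z''X z'(2) by (intro bexI[of _ z'']) auto
      qed
    qed
  qed
qed

text \<open>\<open>entropy_less\<close> is applied with \<open>X\<close> in the role of its
  \<open>Y\<close> and the image of \<open>X\<close> in the role of its \<open>Z\<close>: the
  missing pattern lives in the domain of \<open>\<Delta>\<close>, not in its range.\<close>

lemma entropy_less_if_not_pre_injective:
  assumes net: "right_folner_net I leq F"
    and X: "subshift X" "strongly_irreducible X" "finite_type X"
    and Y: "subshift Y" and loc: "local_map X Y \<Delta>" and ninj: "\<not> pre_injective X \<Delta>"
  shows "entropy I leq F (\<Delta> ` X) < entropy I leq F X"
proof (rule erase_pattern[OF X(1) Y X(3) loc ninj])
  fix x r assume x: "x \<in> X" and erase: "\<And>T z. finite T \<Longrightarrow> T \<subseteq> M \<Longrightarrow>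
      (\<And>s t. s \<in> T \<Longrightarrow> t \<in> T \<Longrightarrow> s \<noteq> t \<Longrightarrow> cell_ball s r \<inter> cell_ball t r = {}) \<Longrightarrow> z \<in> X \<Longrightarrow>
      \<exists>z'\<in>X. \<Delta> z' = \<Delta> z \<and> (\<forall>t\<in>T. \<exists>a\<in>cell_ball m0 r. z' (act (coord t) a) \<noteq> x a)"
  obtain \<kappa> where map: "\<And>x. x \<in> X \<Longrightarrow> \<Delta> x \<in> Y"
    and dep: "\<And>x x' m. x \<in> X \<Longrightarrow> x' \<in> X \<Longrightarrow> m \<in> M \<Longrightarrow>
      (\<And>n. n \<in> cell_ball m \<kappa> \<Longrightarrow> x n = x' n) \<Longrightarrow> \<Delta> x m = \<Delta> x' m"
    using local_mapE[OF X(1) Y loc] by metis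
  have conf: "X \<subseteq> configurations" "\<Delta> ` X \<subseteq> configurations"
    using map subshift_configuration X(1) Y by blast+
  show ?thesis
  proof (rule entropy_less[OF net X(1,2) x order_refl conf(2)])
    show "\<Delta> ` X \<noteq> {}"
      using x by blast
    fix F T assume F: "finite F" "F \<subseteq> M" and T: "T \<subseteq> F" "\<And>t. t \<in> T \<Longrightarrow> cell_ball t r \<subseteq> F"
      and disj: "\<And>s t. s \<in> T \<Longrightarrow> t \<in> T \<Longrightarrow> s \<noteq> t \<Longrightarrow> cell_ball s r \<inter> cell_ball t r = {}"
    have fT: "finite T" "T \<subseteq> M"
      using T(1) F by (auto intro: finite_subset)
    define W where "W = theta_interior \<kappa> F"
    define B where "B = boundary \<kappa> F"
    have W: "W \<subseteq> F" "finite W" "F \<subseteq> W \<union> B"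
      using F boundary_bounds(3)[OF F(2,1), of \<kappa>]
      by (auto simp: W_def B_def theta_interior_def intro: finite_subset)
    have B: "finite B" "B \<subseteq> M"
      using boundary_bounds(1)[OF F(2,1)] by (auto simp: B_def boundary_def theta_closure_def)
    \<comment> \<open>This set depends on \<open>T\<close>, but by \<open>erase\<close> it has the
      same image as \<open>X\<close>.\<close>
    define Z where "Z = {z \<in> X. \<forall>t\<in>T. \<exists>a\<in>cell_ball m0 r. z (act (coord t) a) \<noteq> x a}"
    have "\<Delta> ` X = \<Delta> ` Z"
    proof
      show "\<Delta> ` X \<subseteq> \<Delta> ` Z"
      proof
        fix w assume "w \<in> \<Delta> ` X"
        then obtain z where z: "z \<in> X" "w = \<Delta> z"
          by blast
        obtain z' where z': "z' \<in> X" "\<Delta> z' = \<Delta> z \<and>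
            (\<forall>t\<in>T. \<exists>a\<in>cell_ball m0 r. z' (act (coord t) a) \<noteq> x a)"
          using erase[OF fT disj z(1)] by (rule bexE)
        then have "z' \<in> Z"
          by (simp add: Z_def)
        then show "w \<in> \<Delta> ` Z"
          using z' z(2) by (intro image_eqI[of _ _ z']) simp_all
      qed
    qed (auto simp: Z_def)
    \<comment> \<open>Patterns of \<open>Z\<close> on \<open>F\<close> determine the image on the
      interior \<open>W\<close> only; the rest of \<open>F\<close> is paid for by the boundary
      factor.\<close>
    then have "card (restrictions (\<Delta> ` X) F) \<le> card (restrictions (\<Delta> ` Z) W) * card Q ^ card B"
      using card_restrictions_le[OF conf(2) F W(2,3) B] W(1) F(2) by simp
    also have "card (restrictions (\<Delta> ` Z) W) \<le> card (restrictions Z F)"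
    proof (rule card_local_image[OF _ F])
      show "m \<in> M \<and> cell_ball m \<kappa> \<subseteq> F" if "m \<in> W" for m
        using that F by (auto simp: W_def theta_interior_def)
      show "Z \<subseteq> configurations"
        using conf(1) by (auto simp: Z_def)
      fix x x' m
      assume "x \<in> Z" "x' \<in> Z" and m: "m \<in> M"
        and eq: "\<And>n. n \<in> cell_ball m \<kappa> \<Longrightarrow> x n = x' n"
      then have "x \<in> X" "x' \<in> X"
        by (simp_all add: Z_def)
      then show "\<Delta> x m = \<Delta> x' m"
        using m eq by (rule dep)
    qed
    also have "card (restrictions Z F) \<le> card (missing X F (cell_ball m0 r) x T)"
    proof (rule card_mono)
      show "finite (missing X F (cell_ball m0 r) x T)"
        using restrictions_finite(1)[OF conf(1) F] by (simp add: missing_def)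
      show "restrictions Z F \<subseteq> missing X F (cell_ball m0 r) x T"
      proof
        fix p assume "p \<in> restrictions Z F"
        then obtain z where z: "z \<in> Z" "p = z |` F"
          by (auto simp: restrictions_def)
        have "\<exists>a\<in>cell_ball m0 r. p (act (coord t) a) \<noteq> x a" if t: "t \<in> T" for t
        proof -
          obtain a where a: "a \<in> cell_ball m0 r" "z (act (coord t) a) \<noteq> x a"
            using z t by (auto simp: Z_def)
          then have "act (coord t) a \<in> F"
            using act_cell_ball_coord[OF a(1)] T(2)[OF t] t fT(2) by blast
          with a show ?thesis
            by (intro bexI[of _ a]) (simp_all add: z(2))
        qed
        then show "p \<in> missing X F (cell_ball m0 r) x T"
          using z by (auto simp: missing_def restrictions_def Z_def)
      qed
    qed
    finally show "card (restrictions (\<Delta> ` X) F) \<le>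
        card (missing X F (cell_ball m0 r) x T) * card Q ^ card (boundary \<kappa> F)"
      by (simp add: B_def mult_right_mono)
  qed
qed

section \<open>Images under maps that are pre-injective and under maps that are not
  surjective\<close>

lemma in_theta_closure:
  "m \<in> theta_closure \<theta> F \<longleftrightarrow> m \<in> M \<and> (\<exists>a\<in>F \<inter> M. cell_dist a m \<le> \<theta>)"
  by (auto simp: theta_closure_def in_cell_ball cell_dist_commute[of m])

text \<open>Strong irreducibility prescribes values on finite sets only; finite type then allows the
  glued configuration to be continued by \<open>x0\<close> outside. The resulting extensions differ
  at finitely many cells, as pre-injectivity requires.\<close>

lemma entropy_le_if_pre_injective:
  assumes net: "right_folner_net I leq F"
    and X: "subshift X" "strongly_irreducible X" "finite_type X" "X \<noteq> {}"
    and Y: "subshift Y" and loc: "local_map X Y \<Delta>" and inj: "pre_injective X \<Delta>"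
  shows "entropy I leq F X \<le> entropy I leq F (\<Delta> ` X)"
proof -
  obtain \<kappa> where si: "k_strongly_irreducible \<kappa> X"
    using X(2) by (auto simp: strongly_irreducible_def)
  obtain \<mu> where map: "\<And>x. x \<in> X \<Longrightarrow> \<Delta> x \<in> Y"
    and dep: "\<And>x x' m. x \<in> X \<Longrightarrow> x' \<in> X \<Longrightarrow> m \<in> M \<Longrightarrow>
      (\<And>n. n \<in> cell_ball m \<mu> \<Longrightarrow> x n = x' n) \<Longrightarrow> \<Delta> x m = \<Delta> x' m"
    using local_mapE[OF X(1) Y loc] by metis
  obtain R where "gluing_radius R X"
    using finite_type_gluing_radius[OF X(3)] by blast
  note glue = gluing_radiusD[OF this]
  have conf: "X \<subseteq> configurations" "\<Delta> ` X \<subseteq> configurations"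
    using map subshift_configuration X(1) Y by blast+
  obtain x0 where x0: "x0 \<in> X"
    using X(4) by blast
  \<comment> \<open>The extensions may deviate from \<open>x0\<close> up to distance
    \<open>\<kappa> + R\<close> from \<open>F\<close>, and their images up to \<open>\<mu>\<close>
    further.\<close>
  define \<theta> where "\<theta> = \<kappa> + R + \<mu>"
  have bound: "card (restrictions X F) \<le> card (restrictions (\<Delta> ` X) F) * card Q ^ card (boundary \<theta> F)"
    if F: "finite F" "F \<subseteq> M" for F
  proof -
    define L where "L = theta_closure (\<kappa> + R) F"
    define V where "V = theta_closure \<theta> F"
    have finC: "finite (theta_closure \<rho> F)" "theta_closure \<rho> F \<subseteq> M" for \<rho>
      using boundary_bounds(1,2)[OF F(2,1), of \<rho>] F(1)
      by (auto simp: theta_closure_def intro: finite_subset)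
    have "\<exists>x\<in>X. x |` F = p \<and> (\<forall>m\<in>M - L. x m = x0 m)" if p: "p \<in> restrictions X F" for p
    proof -
      obtain z where z: "z \<in> X" "p = z |` F"
        using p by (auto simp: restrictions_def)
      \<comment> \<open>This annulus starts beyond distance \<open>\<kappa>\<close> from
        \<open>F\<close>, far enough for strong irreducibility, and reaches up to
        \<open>\<kappa> + 2 * R\<close>, so that it contains the outer collar of \<open>L\<close> of
        width \<open>R\<close>.\<close>
      define A where "A = theta_closure (\<kappa> + 2 * R) F - theta_closure \<kappa> F"
      have A: "finite A" "A \<subseteq> M"
        using finC by (auto simp: A_def)
      have far: "\<kappa> < cell_dist a b" if "a \<in> F" "b \<in> A" for a b
        using that F(2) by (force simp: A_def in_theta_closure not_le)
      obtain u where u: "u \<in> X" "\<And>m. m \<in> F \<Longrightarrow> u m = z m" "\<And>m. m \<in> A \<Longrightarrow> u m = x0 m"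
        using strongly_irreducible_glue[OF X(1) si z(1) x0 F A far] by blast
      define x where "x = (\<lambda>m. if m \<in> L then u m else x0 m)"
      have "x \<in> X"
        unfolding x_def
      proof (intro glue u(1) x0)
        show "L \<subseteq> M"
          using finC by (simp add: L_def)
        fix l m assume lm: "l \<in> L" "m \<in> M" "m \<notin> L" "cell_dist l m \<le> R"
        obtain a where a: "a \<in> F" "a \<in> M" "l \<in> M" "cell_dist a l \<le> \<kappa> + R"
          using lm(1) by (auto simp: L_def in_theta_closure)
        have "cell_dist a m \<le> \<kappa> + 2 * R"
          using cell_dist_triangle[of a l m] a lm by simp
        moreover have "theta_closure \<kappa> F \<subseteq> L"
          unfolding L_def in_theta_closure subset_iff by (meson trans_le_add1)
        then have "m \<notin> theta_closure \<kappa> F"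
          using lm(3) by blast
        ultimately have "m \<in> A"
          using a lm(2) by (auto simp: A_def in_theta_closure)
        then show "u m = x0 m"
          by (rule u(3))
      qed
      moreover have "x |` F = p"
        unfolding z(2) restrict_map_eq_iff using u(2) boundary_bounds(4)[OF F(2,1), of "\<kappa> + R"]
        by (auto simp: x_def L_def)
      moreover have "\<forall>m\<in>M - L. x m = x0 m"
        by (simp add: x_def)
      ultimately show ?thesis
        by (intro bexI[of _ x] conjI)
    qed
    then have "\<exists>ext. \<forall>p\<in>restrictions X F. ext p \<in> X \<and> ext p |` F = p \<and> (\<forall>m\<in>M - L. ext p m = x0 m)"
      by (intro bchoice) blast
    then obtain ext where ext: "\<And>p. p \<in> restrictions X F \<Longrightarrow> ext p \<in> X"
      "\<And>p. p \<in> restrictions X F \<Longrightarrow> ext p |` F = p"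
      "\<And>p m. p \<in> restrictions X F \<Longrightarrow> m \<in> M - L \<Longrightarrow> ext p m = x0 m"
      by blast
    \<comment> \<open>Off \<open>V\<close> the images of two extensions agree in any case. If they
      agree on \<open>V\<close> too, pre-injectivity makes the extensions equal, and these restrict
      to \<open>p\<close> and \<open>p'\<close>.\<close>
    have "inj_on (\<lambda>p. \<Delta> (ext p) |` V) (restrictions X F)"
    proof (rule inj_onI)
      fix p p' assume p: "p \<in> restrictions X F" "p' \<in> restrictions X F"
        and eq: "\<Delta> (ext p) |` V = \<Delta> (ext p') |` V"
      have \<Delta>eq: "\<Delta> (ext p) = \<Delta> (ext p')"
      proof (rule configuration_eqI)
        fix m assume m: "m \<in> M"
        show "\<Delta> (ext p) m = \<Delta> (ext p') m"
        proof (cases "m \<in> V")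
          case True
          with eq show ?thesis
            by (simp add: restrict_map_eq_iff)
        next
          case False
          have "n \<in> M - L" if n: "n \<in> cell_ball m \<mu>" for n
          proof (rule ccontr)
            assume "n \<notin> M - L"
            then obtain a where a: "a \<in> F" "a \<in> M" "cell_dist a n \<le> \<kappa> + R" "n \<in> M"
              using n by (auto simp: L_def in_theta_closure in_cell_ball)
            then have "cell_dist a m \<le> \<theta>"
              using cell_dist_triangle[of a n m] m n cell_dist_commute[of n m]
              by (simp add: in_cell_ball \<theta>_def)
            then show False
              using False a m by (auto simp: V_def in_theta_closure)
          qed
          then have "ext p n = ext p' n" if "n \<in> cell_ball m \<mu>" for n
            using ext(3)[OF p(1)] ext(3)[OF p(2)] that by simp
          then show ?thesis
            by (rule dep[OF ext(1)[OF p(1)] ext(1)[OF p(2)] m])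
        qed
      qed (rule subsetD[OF conf(2)] imageI ext(1) p)+
      have "{m \<in> M. ext p m \<noteq> ext p' m} \<subseteq> L"
      proof (rule subsetI, rule ccontr)
        fix m assume "m \<in> {m \<in> M. ext p m \<noteq> ext p' m}" "m \<notin> L"
        then have m: "m \<in> M - L" and neq: "ext p m \<noteq> ext p' m"
          by simp_all
        from ext(3)[OF p(1) m] ext(3)[OF p(2) m] have "ext p m = ext p' m"
          by (simp only:)
        with neq show False ..
      qed
      then have "finite {m \<in> M. ext p m \<noteq> ext p' m}"
        unfolding L_def using finC(1) by (rule finite_subset)
      then have "ext p = ext p'"
        using \<Delta>eq
        by (rule inj[unfolded pre_injective_def, rule_format, OF ext(1)[OF p(1)] ext(1)[OF p(2)]])
      then have "ext p |` F = ext p' |` F"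
        by (rule arg_cong)
      then show "p = p'"
        by (simp only: ext(2)[OF p(1)] ext(2)[OF p(2)])
    qed
    then have "card (restrictions X F) \<le> card (restrictions (\<Delta> ` X) V)"
      by (rule card_inj_on_le)
        (use ext(1) restrictions_finite(1)[OF conf(2)] finC in \<open>auto simp: restrictions_def V_def\<close>)
    also have "\<dots> \<le> card (restrictions (\<Delta> ` X) F) * card Q ^ card (boundary \<theta> F)"
      using boundary_bounds(1,2)[OF F(2,1), of \<theta>] finC F unfolding V_def
      by (intro card_restrictions_le conf(2)) (auto simp: boundary_def)
    finally show ?thesis .
  qed
  have "entropy I leq F X \<le> entropy I leq F (\<Delta> ` X) + ereal 0"
  proof (rule entropy_le_add[OF net conf(1) X(4) conf(2)])
    show "\<Delta> ` X \<noteq> {}"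
      using X(4) by blast
    show "eventually (\<lambda>i. real (card (restrictions X (F i))) \<le>
      exp (0 * real (card (F i))) * real (card (restrictions (\<Delta> ` X) (F i))) *
      real (card Q) ^ card (boundary \<theta> (F i))) (net_filter I leq)"
      using folner_eventually(1)[OF net]
    proof eventually_elim
      case (elim i)
      then have "real (card (restrictions X (F i))) \<le>
          real (card (restrictions (\<Delta> ` X) (F i)) * card Q ^ card (boundary \<theta> (F i)))"
        by (intro of_nat_mono bound) simp_all
      then show ?case
        by simp
    qed
  qed
  then show ?thesis
    by simp
qed

text \<open>By compactness, a finite part of some \<open>y\<close> without preimage is already
  missing from all images, and by equivariance it is missing at every cell.\<close>

lemma entropy_less_if_not_surjective:
  assumes net: "right_folner_net I leq F" and X: "subshift X" "X \<noteq> {}"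
    and Y: "subshift Y" "strongly_irreducible Y" and loc: "local_map X Y \<Delta>"
    and nsurj: "\<Delta> ` X \<noteq> Y"
  shows "entropy I leq F (\<Delta> ` X) < entropy I leq F Y"
proof -
  obtain map: "\<And>x. x \<in> X \<Longrightarrow> \<Delta> x \<in> Y"
    and equi: "\<And>x h. x \<in> X \<Longrightarrow> h \<in> H \<Longrightarrow> \<Delta> (shift h x) = shift h (\<Delta> x)"
    using local_mapE[OF X(1) Y(1) loc] by metis
  have conf: "Y \<subseteq> configurations" "\<Delta> ` X \<subseteq> configurations"
    using map subshift_configuration Y(1) by blast+
  obtain y where y: "y \<in> Y" "y \<notin> \<Delta> ` X"
  proof -
    have "\<Delta> ` X \<subseteq> Y"
      using map by (rule image_subsetI)
    with nsurj have "Y - \<Delta> ` X \<noteq> {}"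
      by simp
    then show ?thesis
      using that by (auto simp only: ex_in_conv[symmetric] Diff_iff)
  qed
  have "\<exists>A. finite A \<and> A \<subseteq> M \<and> \<not> (\<exists>x\<in>X. \<forall>m\<in>A. \<Delta> x m = y m)"
  proof (rule ccontr)
    assume none: "\<not> ?thesis"
    have "y \<in> \<Delta> ` X"
      by (rule local_image_closed[OF X(1) Y(1) loc subsetD[OF conf(1) y(1)]]) (use none in blast)
    with y(2) show False ..
  qed
  then obtain A where A: "finite A" "A \<subseteq> M" "\<not> (\<exists>x\<in>X. \<forall>m\<in>A. \<Delta> x m = y m)"
    by blast
  obtain r where r: "A \<subseteq> cell_ball m0 r"
    using finite_subset_cell_ball[OF A(1,2)] .
  show ?thesis
  proof (rule entropy_less[OF net Y y(1) r conf(2), where \<theta> = 0])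
    show "\<Delta> ` X \<noteq> {}"
      using X(2) by blast
    fix F T assume F: "finite F" "F \<subseteq> M" and T: "T \<subseteq> F" "\<And>t. t \<in> T \<Longrightarrow> cell_ball t r \<subseteq> F"
    have "restrictions (\<Delta> ` X) F \<subseteq> missing Y F A y T"
    proof
      fix p assume "p \<in> restrictions (\<Delta> ` X) F"
      then obtain x where x: "x \<in> X" "p = \<Delta> x |` F"
        by (auto simp: restrictions_def)
      have "\<exists>a\<in>A. p (act (coord t) a) \<noteq> y a" if t: "t \<in> T" for t
      proof -
        have tM: "t \<in> M"
          using t T F by blast
        have h: "inv (coord t) \<in> H"
          using coord_in_H[OF tM] subgroup_H by (simp add: subgroup_def)
        \<comment> \<open>Otherwise the shift of \<open>x\<close> by \<open>inv (coord t)\<close>,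
          again an element of \<open>X\<close>, would have an image that agrees with
          \<open>y\<close> on all of \<open>A\<close>.\<close>
        obtain a where a: "a \<in> A" "shift (inv (coord t)) (\<Delta> x) a \<noteq> y a"
          using A(3) subshift_shift[OF X(1) x(1) h] equi[OF x(1) h] by metis
        have "\<Delta> x \<in> configurations"
          using x(1) conf(2) by blast
        then have "shift (inv (coord t)) (\<Delta> x) a = \<Delta> x (act (coord t) a)"
          using a(1) A(2) tM by (auto simp: shift_configuration)
        moreover have "act (coord t) a \<in> F"
          using act_cell_ball_coord[of a r t] a(1) r T(2)[OF t] tM by blast
        ultimately show ?thesis
          using a by (intro bexI[of _ a]) (auto simp: x(2))
      qed
      then show "p \<in> missing Y F A y T"
        using x map by (auto simp: missing_def restrictions_def)
    qed
    then have "card (restrictions (\<Delta> ` X) F) \<le> card (missing Y F A y T)"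
      using restrictions_finite(1)[OF conf(1) F] by (intro card_mono) (auto simp: missing_def)
    also have "\<dots> \<le> card (missing Y F A y T) * card Q ^ card (boundary 0 F)"
      using card_states_pos[OF subsetD[OF conf(1) y(1)]] by (simp add: Suc_le_eq)
    finally show "card (restrictions (\<Delta> ` X) F) \<le>
        card (missing Y F A y T) * card Q ^ card (boundary 0 F)" .
  qed
qed

end

theorem theorem4p7:
  fixes G :: "('g, 'z) monoid_scheme" (structure)
    and M :: "'m set" and act :: "'g \<Rightarrow> 'm \<Rightarrow> 'm" and m0 :: 'm and coord :: "'m \<Rightarrow> 'g"
    and S :: "'g set set" and H :: "'g set" and Q :: "'q set"
    and I :: "'i set" and leq :: "'i \<Rightarrow> 'i \<Rightarrow> bool" and F :: "'i \<Rightarrow> 'm set"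
    and X Y :: "('m \<rightharpoonup> 'q) set" and \<Delta> :: "('m \<rightharpoonup> 'q) \<Rightarrow> ('m \<rightharpoonup> 'q)"
  assumes "symbolic_setting G M act m0 coord S H Q"
    and "cell_space.right_amenable G M act m0 coord"
    and "symbolic_setting.right_folner_net G M act m0 coord S I leq F"
    and "X \<noteq> {}"
    and "symbolic_setting.subshift G M act H Q X"
    and "symbolic_setting.strongly_irreducible G M act m0 coord S H Q X"
    and "symbolic_setting.finite_type G M act H Q X"
    and "symbolic_setting.subshift G M act H Q Y"
    and "symbolic_setting.strongly_irreducible G M act m0 coord S H Q Y"
    and "symbolic_setting.entropy I leq F X = symbolic_setting.entropy I leq F Y"
    and "symbolic_setting.local_map G M act m0 coord S H Q X Y \<Delta>"
  shows "\<Delta> ` X = Y \<longleftrightarrow> symbolic_setting.pre_injective M X \<Delta>"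
proof -
  interpret symbolic_setting G M act m0 coord S H Q
    by (rule assms(1))
  show ?thesis
  proof
    assume surj: "\<Delta> ` X = Y"
    show "pre_injective X \<Delta>"
    proof (rule ccontr)
      assume "\<not> pre_injective X \<Delta>"
      then have "entropy I leq F (\<Delta> ` X) < entropy I leq F X"
        by (rule entropy_less_if_not_pre_injective[OF assms(3,5-8,11)])
      with surj assms(10) show False
        by simp
    qed
  next
    \<comment> \<open>The image has at least the entropy of \<open>X\<close>, which is that of
      \<open>Y\<close>; a proper subset of \<open>Y\<close> arising as image would have
      less.\<close>
    assume "pre_injective X \<Delta>"
    then have le: "entropy I leq F X \<le> entropy I leq F (\<Delta> ` X)"
      by (rule entropy_le_if_pre_injective[OF assms(3,5-7,4,8,11)])
    show "\<Delta> ` X = Y"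
    proof (rule ccontr)
      assume "\<Delta> ` X \<noteq> Y"
      then have "entropy I leq F (\<Delta> ` X) < entropy I leq F Y"
        by (rule entropy_less_if_not_surjective[OF assms(3,5,4,8,9,11)])
      with le assms(10) show False
        by simp
    qed
  qed
qed

end
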